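(* Let $X$ be a separable Banach space with norm $\|\cdot\|$. Fix a collection $\Lambda$ of distance-like functions $\rho:X\times X\to[0,1]$. Consider a family of Markov kernels $P_t^\theta$ on $X$ indexed by $t\in\mathbb R^+$ and a parameter $\theta$ varying in some set $\Theta$. Assume the following conditions: (H1) There exists a constant $\gamma\ge1$ such that for every $\rho\in\Lambda$ and $\alpha>0$ the distance-like function $\rho_\alpha$ satisfies $$\rho_\alpha(u,v)\le C\,[\rho_{\gamma\alpha}(u,w)+\rho_{\gamma\alpha}(w,v)]$$ for all $u,v,w\in X$ and for some constant $C>0$ (which may depend on $\rho$, $\alpha$ and $\gamma$). (H2) For each $\theta\in\Theta$, there exists a probability measure $\mu_\theta$ on $X$ which is invariant under $P_t^\theta$, $t\in\mathbb R^+$. (H3) There exist $\theta_0\in\Theta$ and $\alpha'>0$ such that for each $\alpha\in(0,\alpha']$ and for each $\rho\in\Lambda$ there exist functions $g:\Theta\to\mathbb R^+$, $R:\mathbb R^+\to\mathbb R^+$, and a measurable function $f:X\to\mathbb R^+\cup\{\infty\}$ such that $$\mathcal W_{\rho_\alpha}(P_t^\theta(u,\cdot),P_t^{\theta_0}(u,\cdot))\le R(t)f(u)g(\theta)$$ for all $\theta\in\Theta$, $t\in\mathbb R^+$ and $u\in X$. (H4) For every $m\ge1$, there exists $\alpha_m>0$ such that for each $\alpha\in(0,\alpha_m]$ there exist $\rho\in\Lambda$, $T>0$ and constants $C_1,C_2>0$ for which $$\sup_{\theta\in\Theta\setminus\{\theta_0\}}\mathcal W_{\rho_\alpha}(\mu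 P_t^\theta,\tilde\mu P_t^\theta)\le C_1e^{-tC_2}\,\mathcal W_{\rho_{\alpha/m}}(\mu,\tilde\mu)$$ for every $\mu,\tilde\mu\in\Pr(X)$ and $t\ge T$, with $\theta_0\in\Theta$ as in (H3). Additionally, regarding (H3), suppose that for each $\alpha\in(0,\alpha']$ and $\rho\in\Lambda$ the corresponding functions $R$, $g$ and $f$ satisfy: (H5) $R$ is continuous and strictly increasing; (H6) $g$ is bounded, and $\lim_{\theta\to\theta_0}g(\theta)=0$; (H7) $\int_Xf(u)\,\mu_{\theta_0}(du)<\infty$, with $\mu_{\theta_0}$ as in (H2). For each $u_0\in X$ and $\theta\in\Theta$, let $u_\theta(t;u_0)$, $t\in\mathbb R^+$, be a stochastic process such that the law of $u_\theta(t;u_0)$ is $P_t^\theta(u_0,\cdot)$ for every $t\in\mathbb R^+$. Then there exists $\hat\alpha>0$ such that for each $\alpha\in(0,\hat\alpha]$ there exists $\rho\in\Lambda$ for which the following inequality holds for every $\theta\in\Theta$, every $u_0\in X$ such that $f(u_0)<\infty$, and every $\rho_\alpha$-Lipschitz function $\varphi:X\to\mathbb R$ with Lipschitz constant $L_\varphi$: $$\sup_{t\in\mathbb R^+}\big|\mathbb E[\varphi(u_\theta(t;u_0))-\varphi(u_{\theta_0}(t;u_0))]\big|\le L_\varphi\,\tilde g(\theta)\Big[\mathcal W_{\rho_{\gamma\alpha}}(\delta_{u_0},\mu_{\theta_0})+f(u_0)+\int_Xf(u)\,\mu_{\theta_0}(du)\Big],$$ where, if $R$ is bounded, $\tilde g(\theta)=C\,g(\theta)$,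 and if $R$ is unbounded, $$\tilde g(\theta)=C\max\Big\{\exp\big(-C_2R^{-1}(C\,g(\theta)^{-q})\big),\ g(\theta),\ g(\theta)^{1-q}\Big\}$$ for $g(\theta)\ne0$, and $\tilde g(\theta)=0$ otherwise. Here, $q$ is any fixed number in $(0,1)$, $C>0$ is a constant which is independent of $\theta$, and $C_2$ is the constant from the inequality in (H4). Consequently, if $\mathcal W_{\rho_{\gamma\alpha}}(\delta_{u_0},\mu_{\theta_0})<\infty$, then $$\lim_{\theta\to\theta_0}\ \sup_{t\in\mathbb R^+}\big|\mathbb E[\varphi(u_\theta(t;u_0))-\varphi(u_{\theta_0}(t;u_0))]\big|=0.$$
   Context: $\Pr(X)$ is the set of Borel probability measures on $X$; $\delta_{u_0}$ is the Dirac measure at $u_0$. A Markov kernel $P$ on $X$ is a map $(u,\mathcal O)\mapsto P(u,\mathcal O)\in[0,1]$, measurable in $u\in X$ and a Borel probability measure in $\mathcal O$; $\mu P(\mathcal O)=\int_X P(u,\mathcal O)\,\mu(du)$, and $\mu$ is invariant under $\{P_t\}_{t\ge0}$ if $\mu P_t=\mu$ for all $t\ge0$. A distance-like function on $X$ is a map $\rho:X\times X\to\mathbb R^+$ that is symmetric, lower semicontinuous, and satisfies $\rho(u,v)=0$ if and only if $u=v$. Its Wasserstein-like extension to $\Pr(X)$ is $\mathcal W_\rho(\mu,\tilde\mu)=\inf_\Gamma\int_{X\times X}\rho(u,v)\,\Gamma(du,dv)\in[0,\infty]$, the infimum being over all couplings $\Gamma$ of $\mu$ and $\tilde\mu$ (probability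 measures on $X\times X$ with marginals $\mu$ and $\tilde\mu$). For $\rho\in\Lambda$ and $a>0$, $\rho_a(u,v)=\rho(u,v)^{1/2}\exp(a\|u\|^2+a\|v\|^2)$, $u,v\in X$. A function $\varphi$ is $\rho_\alpha$-Lipschitz with constant $L_\varphi$ if $|\varphi(u)-\varphi(v)|\le L_\varphi\,\rho_\alpha(u,v)$ for all $u,v\in X$. In the conclusion, $R,g,f$ are the functions from (H3), and $R^{-1}$ is the inverse function of $R$. *)

theory Defs
  imports "HOL-Probability.Probability"
begin

text \<open>
  Lower semicontinuity of \<open>\<rho>\<close> is joint, i.e. with respect to the product topology.
\<close>

definition distance_like :: "('a::topological_space \<Rightarrow> 'a \<Rightarrow> real) \<Rightarrow> bool" where
  "distance_like \<rho> \<longleftrightarrow>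
     (\<forall>u v. 0 \<le> \<rho> u v) \<and>
     (\<forall>u v. \<rho> u v = \<rho> v u) \<and>
     (\<forall>u v. \<rho> u v = 0 \<longleftrightarrow> u = v) \<and>
     (\<forall>z. \<forall>c < \<rho> (fst z) (snd z). eventually (\<lambda>w. c < \<rho> (fst w) (snd w)) (nhds z))"

abbreviation Pr :: "'a::topological_space measure set" where
  "Pr \<equiv> space (prob_algebra borel)"

definition couplings ::
  "'a::topological_space measure \<Rightarrow> 'a measure \<Rightarrow> ('a \<times> 'a) measure set" where
  "couplings \<mu> \<nu> = {\<Gamma> \<in> Pr. distr \<Gamma> borel fst = \<mu> \<and> distr \<Gamma> borel snd = \<nu>}"

definition wasserstein ::
  "('a::topological_space \<Rightarrow> 'a \<Rightarrow> real) \<Rightarrow> 'a measure \<Rightarrow> 'a measure \<Rightarrow> ennreal" where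
  "wasserstein \<rho> \<mu> \<nu> = (INF \<Gamma>\<in>couplings \<mu> \<nu>. \<integral>\<^sup>+z. ennreal (\<rho> (fst z) (snd z)) \<partial>\<Gamma>)"

definition weighted :: "('a::real_normed_vector \<Rightarrow> 'a \<Rightarrow> real) \<Rightarrow> real \<Rightarrow> 'a \<Rightarrow> 'a \<Rightarrow> real" where
  "weighted \<rho> a u v = sqrt (\<rho> u v) * exp (a * (norm u)\<^sup>2 + a * (norm v)\<^sup>2)"

text \<open>
  The function \<open>\<phi>\<close> is required to be Borel measurable, since its expectations are taken:
  a function that is Lipschitz with respect to a merely lower semicontinuous \<open>d\<close>
  (for instance a discrete one) need not be measurable.
\<close>

definition dist_lipschitz ::
  "('a::topological_space \<Rightarrow> 'a \<Rightarrow> real) \<Rightarrow> real \<Rightarrow> ('a \<Rightarrow> real) \<Rightarrow> bool" where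
  "dist_lipschitz d L \<phi> \<longleftrightarrow>
     \<phi> \<in> borel_measurable borel \<and> 0 \<le> L \<and> (\<forall>u v. \<bar>\<phi> u - \<phi> v\<bar> \<le> L * d u v)"

text \<open>
  For a set \<open>I\<close> of parameters, the Markov kernels \<open>P \<theta> t\<close> satisfy the contraction inequality
  with level \<open>\<alpha>\<close>, loss factor \<open>m\<close>, starting time \<open>T\<close> and constants \<open>C1\<close>, \<open>C2\<close>, uniformly in
  \<open>\<theta> \<in> I\<close>. The monadic bind \<open>\<mu> \<bind> P \<theta> t\<close> is the measure \<open>\<mu> P\<^sub>t\<^sup>\<theta>\<close>.
\<close>

definition contraction ::
  "'p set \<Rightarrow> ('p \<Rightarrow> real \<Rightarrow> 'a::real_normed_vector \<Rightarrow> 'a measure) \<Rightarrow> ('a \<Rightarrow> 'a \<Rightarrow> real) \<Rightarrow>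
   real \<Rightarrow> real \<Rightarrow> real \<Rightarrow> real \<Rightarrow> real \<Rightarrow> bool" where
  "contraction I P \<rho> m \<alpha> T C1 C2 \<longleftrightarrow>
     (\<forall>\<mu>\<in>Pr. \<forall>\<nu>\<in>Pr. \<forall>t\<ge>T.
        (SUP \<theta>\<in>I. wasserstein (weighted \<rho> \<alpha>) (\<mu> \<bind> P \<theta> t) (\<nu> \<bind> P \<theta> t))
          \<le> ennreal (C1 * exp (- t * C2)) * wasserstein (weighted \<rho> (\<alpha> / m)) \<mu> \<nu>)"

text \<open>
  The rate \<open>g~(\<theta>)\<close> as a function of \<open>x = g(\<theta>)\<close>. A function \<open>R\<close> on \<open>[0, \<infinity>)\<close> is represented by a
  total function on the reals; boundedness and inverse refer to its restriction to \<open>{0..}\<close>.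
\<close>

definition g_tilde :: "(real \<Rightarrow> real) \<Rightarrow> real \<Rightarrow> real \<Rightarrow> real \<Rightarrow> real \<Rightarrow> real" where
  "g_tilde R C C2 q x =
     (if bounded (R ` {0..}) then C * x
      else if x \<noteq> 0 then
        C * Max {exp (- C2 * the_inv_into {0..} R (C * x powr (- q))), x, x powr (1 - q)}
      else 0)"

end

theory Submission
  imports Defs
begin

text \<open>
  The estimate combines two regimes. Up to a time \<open>\<tau>\<close>, the two laws started at \<open>u\<^sub>0\<close> are close
  because the kernels are: the error is at most \<open>R \<tau> * g \<theta> * f u\<^sub>0\<close>. After \<open>\<tau>\<close>, each
  kernel has forgotten whether it was started at \<open>u\<^sub>0\<close> or from \<open>\<mu> \<theta>\<^sub>0\<close>, up to an exponentially
  small multiple of the distance between these initial laws, and on Lipschitz test functions the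
  equilibria \<open>\<mu> \<theta>\<close> and \<open>\<mu> \<theta>\<^sub>0\<close> differ by a quantity of order \<open>g \<theta>\<close>. If \<open>R\<close> is bounded, the
  first regime covers all times. Otherwise \<open>\<tau>\<close> solves \<open>R \<tau> = C (g \<theta>)\<^sup>-\<^sup>q\<close>: then \<open>\<tau>\<close> is large for
  small \<open>g \<theta>\<close>, while the error \<open>R \<tau> * g \<theta>\<close> is still only \<open>C (g \<theta>)\<^sup>1\<^sup>-\<^sup>q\<close>. The three error terms
  are those in the maximum defining the rate (\<open>rate_choice\<close>).

  All comparisons are made between integrals of one bounded Lipschitz test function, not between
  measures. The only link to couplings is the elementary duality inequality
  \<open>integral_diff_le_wasserstein\<close>. The triangle inequality is then that of the real line, pointwise
  bounds integrate against \<open>\<mu> \<theta>\<^sub>0\<close> without a measurable selection of couplings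
  (\<open>kernel_perturbation\<close>), and a contracting kernel is one that shrinks Lipschitz constants
  (\<open>kernel_bounded_lipschitz\<close>). Consequently the closeness of the equilibria follows by iterating
  one kernel \<open>P \<theta> t\<close> with contraction factor below \<open>1\<close> and summing a geometric series
  (\<open>invariant_measures_close\<close>), even if their Wasserstein distance is not known to be finite.
  The contraction at \<open>\<theta>\<^sub>0\<close> itself is obtained, in its dual form, as a limit of the contractions for
  \<open>\<theta> \<rightarrow> \<theta>\<^sub>0\<close> (\<open>limit_of_contracting_kernels\<close>). General Lipschitz functions are reached by
  truncation (\<open>unbounded_expectation_diff_le\<close>).
\<close>

section \<open>Test functions and the duality inequality\<close>

text \<open>
  Bounded test functions are integrable against every probability measure, and kernels preserve
  boundedness. Only the Lipschitz constant is recorded: estimates in terms of it alone survive the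
  removal of a truncation.
\<close>

definition bounded_lipschitz ::
  "('a::topological_space \<Rightarrow> 'a \<Rightarrow> real) \<Rightarrow> real \<Rightarrow> ('a \<Rightarrow> real) \<Rightarrow> bool" where
  "bounded_lipschitz d L \<phi> \<longleftrightarrow> dist_lipschitz d L \<phi> \<and> bounded (range \<phi>)"

definition kernel_mean :: "('a \<Rightarrow> 'b measure) \<Rightarrow> ('b \<Rightarrow> real) \<Rightarrow> 'a \<Rightarrow> real" where
  "kernel_mean K \<phi> u = (\<integral>x. \<phi> x \<partial>K u)"

text \<open>
  Lower semicontinuity makes every strict superlevel set open.
\<close>

lemma distance_like_measurable:
  fixes \<rho> :: "'a::topological_space \<Rightarrow> 'a \<Rightarrow> real"
  assumes "distance_like \<rho>"
  shows "(\<lambda>z. \<rho> (fst z) (snd z)) \<in> borel_measurable borel"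
proof -
  have "open {z. c < \<rho> (fst z) (snd z)}" for c
  proof (subst open_subopen, intro ballI)
    fix z assume "z \<in> {z. c < \<rho> (fst z) (snd z)}"
    then have "eventually (\<lambda>w. c < \<rho> (fst w) (snd w)) (nhds z)"
      using assms unfolding distance_like_def by blast
    then show "\<exists>T. open T \<and> z \<in> T \<and> T \<subseteq> {z. c < \<rho> (fst z) (snd z)}"
      unfolding eventually_nhds by blast
  qed
  then show ?thesis
    by (auto simp: borel_measurable_iff_greater)
qed

lemma weighted_measurable:
  assumes "distance_like \<rho>"
  shows "(\<lambda>z. weighted \<rho> a (fst z) (snd z)) \<in> borel_measurable borel"
proof -
  have [measurable]: "(\<lambda>z. \<rho> (fst z) (snd z)) \<in> borel_measurable borel"
    using assms by (rule distance_like_measurable)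
  have [measurable]: "(\<lambda>z::'a \<times> 'a. exp (a * (norm (fst z))\<^sup>2 + a * (norm (snd z))\<^sup>2))
      \<in> borel_measurable borel"
    by (intro borel_measurable_continuous_onI continuous_intros)
  show ?thesis
    unfolding weighted_def by measurable
qed

lemma weighted_nonneg: "distance_like \<rho> \<Longrightarrow> 0 \<le> weighted \<rho> a u v"
  by (simp add: weighted_def distance_like_def)

lemma weighted_mono: "distance_like \<rho> \<Longrightarrow> a \<le> b \<Longrightarrow> weighted \<rho> a u v \<le> weighted \<rho> b u v"
  unfolding weighted_def
  by (intro mult_left_mono) (auto simp: distance_like_def intro!: add_mono mult_right_mono)

lemma wasserstein_mono: "(\<And>u v. d u v \<le> d' u v) \<Longrightarrow> wasserstein d \<mu> \<nu> \<le> wasserstein d' \<mu> \<nu>"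
  unfolding wasserstein_def by (intro INF_superset_mono nn_integral_mono ennreal_leI) auto

lemma PrD:
  assumes "\<mu> \<in> Pr"
  shows "prob_space \<mu>" "sets \<mu> = sets borel" "space \<mu> = UNIV"
  using assms sets_eq_imp_space_eq[of \<mu> borel] by (auto simp: space_prob_algebra)

lemma bounded_lipschitzD:
  assumes "bounded_lipschitz d L \<phi>"
  shows "\<phi> \<in> borel_measurable borel" "0 \<le> L" "\<bar>\<phi> u - \<phi> v\<bar> \<le> L * d u v"
    "\<exists>B. \<forall>u. \<bar>\<phi> u\<bar> \<le> B"
  using assms by (auto simp: bounded_lipschitz_def dist_lipschitz_def bounded_iff)

lemma bounded_measurable_integrable:
  fixes \<phi> :: "'a::topological_space \<Rightarrow> real"
  assumes "\<mu> \<in> Pr" "\<phi> \<in> borel_measurable borel" "\<And>u. \<bar>\<phi> u\<bar> \<le> B"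
  shows "integrable \<mu> \<phi>"
proof -
  interpret prob_space \<mu> using PrD[OF assms(1)] by simp
  show ?thesis
    using assms(2,3) PrD(2)[OF assms(1)]
    by (intro integrable_const_bound[where B=B]) (auto cong: measurable_cong_sets)
qed

lemma bounded_lipschitz_integrable:
  assumes "\<mu> \<in> Pr" "bounded_lipschitz d L \<phi>"
  shows "integrable \<mu> \<phi>"
  using bounded_measurable_integrable[OF assms(1)] bounded_lipschitzD[OF assms(2)] by blast

text \<open>
  This is the elementary half of Kantorovich duality: under a coupling both integrals live on the
  same space, where the difference is integrated pointwise.
\<close>

lemma integral_diff_le_coupling:
  fixes d :: "'a::topological_space \<Rightarrow> 'a \<Rightarrow> real"
  assumes d: "(\<lambda>z. d (fst z) (snd z)) \<in> borel_measurable borel"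
    and \<phi>: "bounded_lipschitz d L \<phi>" and \<Gamma>: "\<Gamma> \<in> couplings \<mu> \<nu>"
  shows "ennreal \<bar>(\<integral>u. \<phi> u \<partial>\<mu>) - (\<integral>u. \<phi> u \<partial>\<nu>)\<bar>
    \<le> ennreal L * (\<integral>\<^sup>+z. ennreal (d (fst z) (snd z)) \<partial>\<Gamma>)"
proof -
  have \<Gamma>P: "\<Gamma> \<in> Pr" and eq: "\<mu> = distr \<Gamma> borel fst" "\<nu> = distr \<Gamma> borel snd"
    using \<Gamma> by (auto simp: couplings_def)
  note [measurable_cong] = PrD(2)[OF \<Gamma>P]
  note [measurable] = d bounded_lipschitzD(1)[OF \<phi>]
  have [measurable]: "(fst :: 'a \<times> 'a \<Rightarrow> 'a) \<in> borel_measurable borel"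
    "(snd :: 'a \<times> 'a \<Rightarrow> 'a) \<in> borel_measurable borel"
    by (intro borel_measurable_continuous_onI continuous_intros)+
  have int: "integrable \<Gamma> (\<lambda>z. \<phi> (fst z))" "integrable \<Gamma> (\<lambda>z. \<phi> (snd z))"
    using bounded_lipschitzD(4)[OF \<phi>]
    by (auto intro!: bounded_measurable_integrable[OF \<Gamma>P])
  have "(\<integral>u. \<phi> u \<partial>\<mu>) - (\<integral>u. \<phi> u \<partial>\<nu>) = (\<integral>z. \<phi> (fst z) - \<phi> (snd z) \<partial>\<Gamma>)"
    unfolding eq by (simp add: integral_distr int)
  then have "ennreal \<bar>(\<integral>u. \<phi> u \<partial>\<mu>) - (\<integral>u. \<phi> u \<partial>\<nu>)\<bar>
      \<le> (\<integral>\<^sup>+z. ennreal \<bar>\<phi> (fst z) - \<phi> (snd z)\<bar> \<partial>\<Gamma>)"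
    using integral_norm_bound_ennreal[OF Bochner_Integration.integrable_diff[OF int]] by simp
  also have "\<dots> \<le> (\<integral>\<^sup>+z. ennreal L * ennreal (d (fst z) (snd z)) \<partial>\<Gamma>)"
    using bounded_lipschitzD(2,3)[OF \<phi>]
    by (intro nn_integral_mono) (simp flip: ennreal_mult' add: ennreal_leI)
  also have "\<dots> = ennreal L * (\<integral>\<^sup>+z. ennreal (d (fst z) (snd z)) \<partial>\<Gamma>)"
    by (rule nn_integral_cmult) measurable
  finally show ?thesis .
qed

text \<open>
  The case \<open>L = 0\<close> is separate because \<open>0 * \<infinity> = 0\<close> and the infimum may be infinite: there
  the test function is constant.
\<close>

lemma integral_diff_le_wasserstein:
  fixes d :: "'a::topological_space \<Rightarrow> 'a \<Rightarrow> real"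
  assumes d: "(\<lambda>z. d (fst z) (snd z)) \<in> borel_measurable borel"
    and \<phi>: "bounded_lipschitz d L \<phi>" and Pr: "\<mu> \<in> Pr" "\<nu> \<in> Pr"
  shows "ennreal \<bar>(\<integral>u. \<phi> u \<partial>\<mu>) - (\<integral>u. \<phi> u \<partial>\<nu>)\<bar> \<le> ennreal L * wasserstein d \<mu> \<nu>"
proof (cases "L = 0")
  case True
  obtain c where "\<phi> = (\<lambda>_. c)"
  proof
    show "\<phi> = (\<lambda>_. \<phi> undefined)"
      using bounded_lipschitzD(3)[OF \<phi>, of _ undefined] True by auto
  qed
  then show ?thesis
    using PrD(1)[OF Pr(1)] PrD(1)[OF Pr(2)] by (simp add: prob_space.prob_space)
next
  case False
  then have L: "0 < L"
    using bounded_lipschitzD(2)[OF \<phi>] by simp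
  have "ennreal \<bar>(\<integral>u. \<phi> u \<partial>\<mu>) - (\<integral>u. \<phi> u \<partial>\<nu>)\<bar> / ennreal L \<le> wasserstein d \<mu> \<nu>"
    unfolding wasserstein_def
    by (intro INF_greatest divide_le_posI_ennreal integral_diff_le_coupling d \<phi>)
       (use L in auto)
  then have "ennreal L * (ennreal \<bar>(\<integral>u. \<phi> u \<partial>\<mu>) - (\<integral>u. \<phi> u \<partial>\<nu>)\<bar> / ennreal L)
      \<le> ennreal L * wasserstein d \<mu> \<nu>"
    by (rule mult_left_mono) simp
  then show ?thesis
    using L by (simp add: ennreal_times_divide mult_divide_eq_ennreal mult.commute[of "ennreal L" "ennreal \<bar>_\<bar>"])
qed

text \<open>
  The Dirac measure at \<open>(u, v)\<close> couples the two Dirac measures.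
\<close>

lemma wasserstein_return_le:
  fixes d :: "'a::topological_space \<Rightarrow> 'a \<Rightarrow> real"
  assumes d: "(\<lambda>z. d (fst z) (snd z)) \<in> borel_measurable borel"
  shows "wasserstein d (return borel u) (return borel v) \<le> ennreal (d u v)"
proof -
  have [measurable]: "(fst :: 'a \<times> 'a \<Rightarrow> 'a) \<in> borel_measurable borel"
    "(snd :: 'a \<times> 'a \<Rightarrow> 'a) \<in> borel_measurable borel"
    by (intro borel_measurable_continuous_onI continuous_intros)+
  have "return borel (u, v) \<in> couplings (return borel u) (return borel v)"
    by (simp add: couplings_def space_prob_algebra prob_space_return distr_return)
  then have "wasserstein d (return borel u) (return borel v)
      \<le> (\<integral>\<^sup>+z. ennreal (d (fst z) (snd z)) \<partial>return borel (u, v))"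
    unfolding wasserstein_def by (rule INF_lower)
  also have "\<dots> = ennreal (d u v)"
    using d by (subst nn_integral_return) auto
  finally show ?thesis .
qed

text \<open>
  A Lipschitz \<open>\<phi>\<close> need not be integrable against either law, and the joint law of \<open>X\<close> and \<open>Y\<close> is
  arbitrary, so \<open>\<phi>\<close> is truncated to \<open>[-n, n]\<close>. Truncation does not increase the Lipschitz
  constant and is a contraction of the real line, so that \<open>\<bar>\<phi>(X) - \<phi>(Y)\<bar>\<close> dominates all the
  truncated differences. If this dominating function is not integrable, the Bochner integral on
  the left is \<open>0\<close> by convention.
\<close>

lemma unbounded_expectation_diff_le:
  assumes M: "prob_space M" and X: "X \<in> borel_measurable M" and Y: "Y \<in> borel_measurable M"
    and \<phi>: "dist_lipschitz d L \<phi>"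
    and bound: "\<And>\<psi>. bounded_lipschitz d L \<psi> \<Longrightarrow>
      ennreal \<bar>(\<integral>u. \<psi> u \<partial>distr M borel X) - (\<integral>u. \<psi> u \<partial>distr M borel Y)\<bar> \<le> b"
  shows "ennreal \<bar>\<integral>\<omega>. \<phi> (X \<omega>) - \<phi> (Y \<omega>) \<partial>M\<bar> \<le> b"
proof (cases "integrable M (\<lambda>\<omega>. \<phi> (X \<omega>) - \<phi> (Y \<omega>))")
  case False
  then show ?thesis by (simp add: not_integrable_integral_eq)
next
  case True
  interpret prob_space M by (rule M)
  note [measurable] = X Y
  have \<phi>': "\<phi> \<in> borel_measurable borel" "0 \<le> L" "\<And>u v. \<bar>\<phi> u - \<phi> v\<bar> \<le> L * d u v"
    using \<phi> by (auto simp: dist_lipschitz_def)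
  note [measurable] = \<phi>'(1)
  define \<psi> where "\<psi> n u = max (- real n) (min (real n) (\<phi> u))" for n u
  have [measurable]: "\<psi> n \<in> borel_measurable borel" for n
    unfolding \<psi>_def by measurable
  have nonexp: "\<bar>\<psi> n u - \<psi> n v\<bar> \<le> \<bar>\<phi> u - \<phi> v\<bar>" for n u v
    unfolding \<psi>_def by linarith
  have abs: "\<bar>\<psi> n u\<bar> \<le> real n" for n u
    unfolding \<psi>_def by linarith
  have lip: "bounded_lipschitz d L (\<psi> n)" for n
    unfolding bounded_lipschitz_def dist_lipschitz_def bounded_iff
    using \<phi>'(2) order_trans[OF nonexp \<phi>'(3)] abs by (auto intro!: exI[of _ "real n"])
  have int: "integrable M (\<lambda>\<omega>. \<psi> n (Z \<omega>))" if [measurable]: "Z \<in> borel_measurable M" for n Z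
    by (rule integrable_const_bound[where B="real n"]) (use abs in auto)
  have "(\<lambda>n. \<integral>\<omega>. \<psi> n (X \<omega>) - \<psi> n (Y \<omega>) \<partial>M) \<longlonglongrightarrow> (\<integral>\<omega>. \<phi> (X \<omega>) - \<phi> (Y \<omega>) \<partial>M)"
  proof (rule integral_dominated_convergence[where w="\<lambda>\<omega>. \<bar>\<phi> (X \<omega>) - \<phi> (Y \<omega>)\<bar>"])
    have "(\<lambda>n. \<psi> n u) \<longlonglongrightarrow> \<phi> u" for u
    proof (rule tendsto_eventually)
      show "\<forall>\<^sub>F n in sequentially. \<psi> n u = \<phi> u"
        using eventually_ge_at_top[of "nat \<lceil>\<bar>\<phi> u\<bar>\<rceil>"]
      proof eventually_elim
        case (elim n)
        then have "\<bar>\<phi> u\<bar> \<le> real n" by linarith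
        then show ?case unfolding \<psi>_def by linarith
      qed
    qed
    then show "AE \<omega> in M. (\<lambda>n. \<psi> n (X \<omega>) - \<psi> n (Y \<omega>)) \<longlonglongrightarrow> \<phi> (X \<omega>) - \<phi> (Y \<omega>)"
      by (intro AE_I2 tendsto_diff)
  qed (use True nonexp in auto)
  then have lim: "(\<lambda>n. ennreal \<bar>\<integral>\<omega>. \<psi> n (X \<omega>) - \<psi> n (Y \<omega>) \<partial>M\<bar>)
      \<longlonglongrightarrow> ennreal \<bar>\<integral>\<omega>. \<phi> (X \<omega>) - \<phi> (Y \<omega>) \<partial>M\<bar>"
    by (intro tendsto_ennrealI tendsto_rabs)
  have "ennreal \<bar>\<integral>\<omega>. \<psi> n (X \<omega>) - \<psi> n (Y \<omega>) \<partial>M\<bar> \<le> b" for n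
    using bound[OF lip[of n]] by (simp add: integral_distr int)
  then show ?thesis
    by (intro Lim_bounded[OF lim]) blast
qed

section \<open>Markov kernels acting on test functions\<close>

lemma return_Pr: "return borel u \<in> Pr"
  by (simp add: space_prob_algebra prob_space_return)

lemma kernel_Pr:
  assumes "K \<in> borel \<rightarrow>\<^sub>M prob_algebra borel"
  shows "K u \<in> Pr"
  using measurable_space[OF assms, of u] by simp

lemma bind_Pr:
  assumes "\<nu> \<in> Pr" and K: "K \<in> borel \<rightarrow>\<^sub>M prob_algebra borel"
  shows "\<nu> \<bind> K \<in> Pr"
proof -
  note \<nu> = PrD[OF assms(1)]
  interpret prob_space \<nu> by (rule \<nu>(1))
  have K': "K \<in> \<nu> \<rightarrow>\<^sub>M subprob_algebra borel"
    using measurable_prob_algebraD[OF K] \<nu>(2) by (simp cong: measurable_cong_sets)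
  show ?thesis
    using prob_space_bind[OF _ K'] PrD(1)[OF kernel_Pr[OF K]]
      sets_bind[where f=K and N=borel, OF sets_kernel[OF K'] not_empty]
    by (simp add: space_prob_algebra)
qed

lemma
  fixes \<phi> :: "'b::topological_space \<Rightarrow> real"
  assumes K: "K \<in> borel \<rightarrow>\<^sub>M prob_algebra borel" and \<phi>: "\<phi> \<in> borel_measurable borel"
    and B: "\<And>x. \<bar>\<phi> x\<bar> \<le> B"
  shows kernel_mean_measurable: "kernel_mean K \<phi> \<in> borel_measurable borel"
    and kernel_mean_bounded: "\<bar>kernel_mean K \<phi> u\<bar> \<le> B"
    and integral_bind_kernel: "\<nu> \<in> Pr \<Longrightarrow> (\<integral>x. \<phi> x \<partial>(\<nu> \<bind> K)) = (\<integral>u. kernel_mean K \<phi> u \<partial>\<nu>)"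
proof -
  note K' = measurable_prob_algebraD[OF K]
  show "kernel_mean K \<phi> \<in> borel_measurable borel"
    using measurable_compose[OF K' integral_measurable_subprob_algebra[OF \<phi>]]
    by (simp add: kernel_mean_def[abs_def])
  show "\<bar>kernel_mean K \<phi> u\<bar> \<le> B" for u
  proof -
    note Ku = kernel_Pr[OF K, of u]
    interpret prob_space "K u" using PrD[OF Ku] by simp
    have "\<bar>\<integral>x. \<phi> x \<partial>K u\<bar> \<le> (\<integral>x. \<bar>\<phi> x\<bar> \<partial>K u)"
      by (rule integral_abs_bound)
    also have "\<dots> \<le> (\<integral>x. B \<partial>K u)"
      by (intro integral_mono integrable_abs bounded_measurable_integrable[OF Ku \<phi> B] B) simp
    finally have "\<bar>\<integral>x. \<phi> x \<partial>K u\<bar> \<le> (\<integral>x. B \<partial>K u)" .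
    then show ?thesis by (simp add: kernel_mean_def prob_space)
  qed
  show "(\<integral>x. \<phi> x \<partial>(\<nu> \<bind> K)) = (\<integral>u. kernel_mean K \<phi> u \<partial>\<nu>)" if \<nu>: "\<nu> \<in> Pr"
  proof -
    interpret prob_space \<nu> using PrD[OF \<nu>] by simp
    have "emeasure (K u) (space (K u)) \<le> ennreal 1" for u
      using prob_space.emeasure_space_1[OF PrD(1)[OF kernel_Pr[OF K, of u]]] by simp
    then show ?thesis
      unfolding kernel_mean_def
      using K' PrD(2)[OF \<nu>] B \<phi>
      by (intro integral_bind[where K=borel and B=B and B'=1] finite_measure_axioms)
         (auto cong: measurable_cong_sets)
  qed
qed

lemma ennreal_abs_diff_triangle:
  "ennreal \<bar>a - c\<bar> \<le> ennreal \<bar>a - b\<bar> + ennreal \<bar>b - c\<bar>"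
  by (auto simp flip: ennreal_plus intro!: ennreal_leI)

definition wasserstein_contracting ::
  "('a::topological_space \<Rightarrow> 'a \<Rightarrow> real) \<Rightarrow> real \<Rightarrow> ('a \<Rightarrow> 'a measure) \<Rightarrow> bool" where
  "wasserstein_contracting d \<kappa> K \<longleftrightarrow> 0 \<le> \<kappa> \<and>
     (\<forall>\<mu>\<in>Pr. \<forall>\<nu>\<in>Pr. wasserstein d (\<mu> \<bind> K) (\<nu> \<bind> K) \<le> ennreal \<kappa> * wasserstein d \<mu> \<nu>)"

definition kernels_close ::
  "('a::topological_space \<Rightarrow> 'a \<Rightarrow> real) \<Rightarrow> real \<Rightarrow> ('a \<Rightarrow> ennreal) \<Rightarrow>
   ('a \<Rightarrow> 'a measure) \<Rightarrow> ('a \<Rightarrow> 'a measure) \<Rightarrow> bool" where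
  "kernels_close d c f K K\<^sub>0 \<longleftrightarrow> (\<forall>u. wasserstein d (K u) (K\<^sub>0 u) \<le> ennreal c * f u)"

context
  fixes d :: "'a::topological_space \<Rightarrow> 'a \<Rightarrow> real"
  assumes d_measurable: "(\<lambda>z. d (fst z) (snd z)) \<in> borel_measurable borel"
    and d_nonneg: "\<And>u v. 0 \<le> d u v"
begin

text \<open>
  Testing the contraction on Dirac measures turns it into a statement about functions: a
  contracting kernel shrinks Lipschitz constants. This dual form can be iterated without asking
  whether any Wasserstein distance is finite.
\<close>

lemma kernel_bounded_lipschitz:
  assumes K: "K \<in> borel \<rightarrow>\<^sub>M prob_algebra borel" and contr: "wasserstein_contracting d \<kappa> K"
    and \<phi>: "bounded_lipschitz d L \<phi>"
  shows "bounded_lipschitz d (\<kappa> * L) (kernel_mean K \<phi>)"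
proof -
  have \<kappa>: "0 \<le> \<kappa>" and L: "0 \<le> L"
    using contr bounded_lipschitzD(2)[OF \<phi>] by (auto simp: wasserstein_contracting_def)
  obtain B where B: "\<And>u. \<bar>\<phi> u\<bar> \<le> B"
    using bounded_lipschitzD(4)[OF \<phi>] by blast
  note \<phi>m = bounded_lipschitzD(1)[OF \<phi>]
  have "\<bar>kernel_mean K \<phi> u - kernel_mean K \<phi> v\<bar> \<le> \<kappa> * L * d u v" for u v
  proof -
    have ret: "return borel x \<bind> K = K x" for x
      by (rule bind_return[OF measurable_prob_algebraD[OF K]]) simp
    have "wasserstein d (K u) (K v) \<le> ennreal \<kappa> * wasserstein d (return borel u) (return borel v)"
      using contr return_Pr[of u] return_Pr[of v]
      unfolding wasserstein_contracting_def by (metis ret)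
    also have "\<dots> \<le> ennreal \<kappa> * ennreal (d u v)"
      by (intro mult_left_mono wasserstein_return_le d_measurable) simp
    finally have W: "wasserstein d (K u) (K v) \<le> ennreal \<kappa> * ennreal (d u v)" .
    have "ennreal \<bar>kernel_mean K \<phi> u - kernel_mean K \<phi> v\<bar> \<le> ennreal L * wasserstein d (K u) (K v)"
      unfolding kernel_mean_def
      by (intro integral_diff_le_wasserstein d_measurable \<phi> kernel_Pr[OF K])
    also have "\<dots> \<le> ennreal L * (ennreal \<kappa> * ennreal (d u v))"
      by (intro mult_left_mono W) simp
    also have "ennreal L * (ennreal \<kappa> * ennreal (d u v)) = ennreal (\<kappa> * L * d u v)"
      using \<kappa> L d_nonneg[of u v] by (simp add: mult_ac flip: ennreal_mult)
    finally show ?thesis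
      using \<kappa> L d_nonneg[of u v] by (subst (asm) ennreal_le_iff) auto
  qed
  moreover have "bounded (range (kernel_mean K \<phi>))"
    using kernel_mean_bounded[OF K \<phi>m B] by (auto simp: bounded_iff)
  ultimately show ?thesis
    using \<kappa> L kernel_mean_measurable[OF K \<phi>m B]
    by (auto simp: bounded_lipschitz_def dist_lipschitz_def)
qed

text \<open>
  Averaging the pointwise duality inequality over \<open>\<nu>\<close> replaces the convexity of the
  Wasserstein functional, which would require choosing nearly optimal couplings of \<open>K u\<close> and
  \<open>K\<^sub>0 u\<close> measurably in \<open>u\<close>.
\<close>

lemma kernel_perturbation:
  assumes K: "K \<in> borel \<rightarrow>\<^sub>M prob_algebra borel" and K\<^sub>0: "K\<^sub>0 \<in> borel \<rightarrow>\<^sub>M prob_algebra borel"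
    and close: "kernels_close d c f K K\<^sub>0" and f: "f \<in> borel_measurable borel"
    and \<phi>: "bounded_lipschitz d L \<phi>" and \<nu>: "\<nu> \<in> Pr"
  shows "ennreal \<bar>(\<integral>u. \<phi> u \<partial>(\<nu> \<bind> K)) - (\<integral>u. \<phi> u \<partial>(\<nu> \<bind> K\<^sub>0))\<bar>
    \<le> ennreal (L * c) * (\<integral>\<^sup>+u. f u \<partial>\<nu>)"
proof -
  obtain B where B: "\<And>u. \<bar>\<phi> u\<bar> \<le> B"
    using bounded_lipschitzD(4)[OF \<phi>] by blast
  note \<phi>m = bounded_lipschitzD(1)[OF \<phi>]
  note [measurable_cong] = PrD(2)[OF \<nu>]
  have int: "integrable \<nu> (kernel_mean K' \<phi>)" if "K' \<in> borel \<rightarrow>\<^sub>M prob_algebra borel" for K'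
    using bounded_measurable_integrable[OF \<nu> kernel_mean_measurable[OF that \<phi>m B]
        kernel_mean_bounded[OF that \<phi>m B]] .
  have "(\<integral>u. \<phi> u \<partial>(\<nu> \<bind> K)) - (\<integral>u. \<phi> u \<partial>(\<nu> \<bind> K\<^sub>0))
      = (\<integral>u. kernel_mean K \<phi> u - kernel_mean K\<^sub>0 \<phi> u \<partial>\<nu>)"
    using integral_bind_kernel[OF K \<phi>m B \<nu>] integral_bind_kernel[OF K\<^sub>0 \<phi>m B \<nu>]
    by (simp add: int K K\<^sub>0)
  then have "ennreal \<bar>(\<integral>u. \<phi> u \<partial>(\<nu> \<bind> K)) - (\<integral>u. \<phi> u \<partial>(\<nu> \<bind> K\<^sub>0))\<bar>
      \<le> (\<integral>\<^sup>+u. ennreal \<bar>kernel_mean K \<phi> u - kernel_mean K\<^sub>0 \<phi> u\<bar> \<partial>\<nu>)"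
    using integral_norm_bound_ennreal[OF Bochner_Integration.integrable_diff[OF int[OF K] int[OF K\<^sub>0]]]
    by simp
  also have "\<dots> \<le> (\<integral>\<^sup>+u. ennreal (L * c) * f u \<partial>\<nu>)"
  proof (rule nn_integral_mono)
    fix u
    have "ennreal \<bar>kernel_mean K \<phi> u - kernel_mean K\<^sub>0 \<phi> u\<bar> \<le> ennreal L * wasserstein d (K u) (K\<^sub>0 u)"
      unfolding kernel_mean_def
      by (intro integral_diff_le_wasserstein d_measurable \<phi> kernel_Pr K K\<^sub>0)
    also have "\<dots> \<le> ennreal L * (ennreal c * f u)"
      using close by (intro mult_left_mono) (auto simp: kernels_close_def)
    also have "\<dots> = ennreal (L * c) * f u"
      using bounded_lipschitzD(2)[OF \<phi>] by (simp add: ennreal_mult' mult.assoc)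
    finally show "ennreal \<bar>kernel_mean K \<phi> u - kernel_mean K\<^sub>0 \<phi> u\<bar> \<le> ennreal (L * c) * f u" .
  qed
  also have "\<dots> = ennreal (L * c) * (\<integral>\<^sup>+u. f u \<partial>\<nu>)"
    using f by (intro nn_integral_cmult) simp
  finally show ?thesis .
qed

text \<open>
  When the Lipschitz constants vanish, the functions become constant in the limit, although \<open>d\<close>
  may be unbounded and not integrable; boundedness of the functions allows dominated
  convergence.
\<close>

lemma vanishing_lipschitz_mean:
  assumes \<nu>: "\<nu> \<in> Pr" and \<psi>: "\<And>n. bounded_lipschitz d (l n) (\<psi> n)" and l: "l \<longlonglongrightarrow> 0"
    and B: "\<And>n u. \<bar>\<psi> n u\<bar> \<le> B"
  shows "(\<lambda>n. (\<integral>u. \<psi> n u \<partial>\<nu>) - \<psi> n z) \<longlonglongrightarrow> 0"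
proof -
  interpret prob_space \<nu> using PrD[OF \<nu>] by simp
  note [measurable_cong] = PrD(2)[OF \<nu>]
  have [measurable]: "\<psi> n \<in> borel_measurable borel" for n
    using bounded_lipschitzD(1)[OF \<psi>] .
  have "(\<lambda>n. \<integral>u. \<psi> n u - \<psi> n z \<partial>\<nu>) \<longlonglongrightarrow> (\<integral>u. 0 \<partial>\<nu>)"
  proof (rule integral_dominated_convergence[where w="\<lambda>_. 2 * B"])
    have "(\<lambda>n. \<psi> n u - \<psi> n z) \<longlonglongrightarrow> 0" for u
    proof (rule Lim_null_comparison)
      show "\<forall>\<^sub>F n in sequentially. norm (\<psi> n u - \<psi> n z) \<le> l n * d u z"
        using bounded_lipschitzD(3)[OF \<psi>] by simp
      show "(\<lambda>n. l n * d u z) \<longlonglongrightarrow> 0"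
        using tendsto_mult_right[OF l] by simp
    qed
    then show "AE u in \<nu>. (\<lambda>n. \<psi> n u - \<psi> n z) \<longlonglongrightarrow> 0" by simp
    have "\<bar>\<psi> n u - \<psi> n z\<bar> \<le> 2 * B" for n u
      using B[of n u] B[of n z] by linarith
    then show "AE u in \<nu>. norm (\<psi> n u - \<psi> n z) \<le> 2 * B" for n by simp
  qed auto
  moreover have "(\<integral>u. \<psi> n u - \<psi> n z \<partial>\<nu>) = (\<integral>u. \<psi> n u \<partial>\<nu>) - \<psi> n z" for n
    using bounded_lipschitz_integrable[OF \<nu> \<psi>] by (simp add: prob_space)
  ultimately show ?thesis by simp
qed

text \<open>
  By invariance, replacing \<open>\<phi>\<close> by \<open>K \<phi>\<close> leaves the integral against \<open>\<nu>\<close> unchanged and alters the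
  integral against \<open>\<nu>\<^sub>0\<close> by at most the perturbation error. The iterates of \<open>\<phi>\<close> under \<open>K\<close> have
  Lipschitz constants \<open>\<kappa>\<^sup>n L\<close>, so these errors form a geometric series, and the discrepancy left
  after \<open>n\<close> replacements tends to \<open>0\<close>. A direct fixed point estimate for the distance of \<open>\<nu>\<close>
  and \<open>\<nu>\<^sub>0\<close> would need that distance to be finite.
\<close>

lemma invariant_measures_close:
  assumes K: "K \<in> borel \<rightarrow>\<^sub>M prob_algebra borel" and K\<^sub>0: "K\<^sub>0 \<in> borel \<rightarrow>\<^sub>M prob_algebra borel"
    and contr: "wasserstein_contracting d \<kappa> K" "\<kappa> < 1"
    and close: "kernels_close d c f K K\<^sub>0" "0 \<le> c" and f: "f \<in> borel_measurable borel"
    and \<nu>: "\<nu> \<in> Pr" "\<nu> \<bind> K = \<nu>" and \<nu>\<^sub>0: "\<nu>\<^sub>0 \<in> Pr" "\<nu>\<^sub>0 \<bind> K\<^sub>0 = \<nu>\<^sub>0"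
    and fin: "(\<integral>\<^sup>+u. f u \<partial>\<nu>\<^sub>0) < \<infinity>"
    and \<phi>: "bounded_lipschitz d L \<phi>"
  shows "ennreal \<bar>(\<integral>u. \<phi> u \<partial>\<nu>) - (\<integral>u. \<phi> u \<partial>\<nu>\<^sub>0)\<bar>
    \<le> ennreal (L * (c / (1 - \<kappa>))) * (\<integral>\<^sup>+u. f u \<partial>\<nu>\<^sub>0)"
proof -
  obtain r where r: "0 \<le> r" "(\<integral>\<^sup>+u. f u \<partial>\<nu>\<^sub>0) = ennreal r"
    using fin by (cases "\<integral>\<^sup>+u. f u \<partial>\<nu>\<^sub>0" rule: ennreal_cases) auto
  have \<kappa>: "0 \<le> \<kappa>" using contr by (simp add: wasserstein_contracting_def)
  let ?D = "\<lambda>\<psi>. \<bar>(\<integral>u. \<psi> u \<partial>\<nu>) - (\<integral>u. \<psi> u \<partial>\<nu>\<^sub>0)\<bar>"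
  have step: "?D \<phi> \<le> ?D (kernel_mean K \<phi>) + L * c * r" if \<phi>: "bounded_lipschitz d L \<phi>" for L \<phi>
  proof -
    obtain B where B: "\<And>u. \<bar>\<phi> u\<bar> \<le> B"
      using bounded_lipschitzD(4)[OF \<phi>] by blast
    note mean = integral_bind_kernel[OF K bounded_lipschitzD(1)[OF \<phi>] B]
    have L: "0 \<le> L" by (rule bounded_lipschitzD(2)[OF \<phi>])
    have "ennreal \<bar>(\<integral>u. kernel_mean K \<phi> u \<partial>\<nu>\<^sub>0) - (\<integral>u. \<phi> u \<partial>\<nu>\<^sub>0)\<bar> \<le> ennreal (L * c * r)"
      using kernel_perturbation[OF K K\<^sub>0 close(1) f \<phi> \<nu>\<^sub>0(1)] mean[OF \<nu>\<^sub>0(1)] \<nu>\<^sub>0(2) r L close(2)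
      by (simp add: ennreal_mult)
    then have "\<bar>(\<integral>u. kernel_mean K \<phi> u \<partial>\<nu>\<^sub>0) - (\<integral>u. \<phi> u \<partial>\<nu>\<^sub>0)\<bar> \<le> L * c * r"
      using L close(2) r(1) by (subst (asm) ennreal_le_iff) auto
    moreover have "(\<integral>u. \<phi> u \<partial>\<nu>) = (\<integral>u. kernel_mean K \<phi> u \<partial>\<nu>)"
      using mean[OF \<nu>(1)] \<nu>(2) by simp
    ultimately show ?thesis by linarith
  qed
  have iter: "?D \<phi> \<le> L * c * r / (1 - \<kappa>) + ?D ((kernel_mean K ^^ n) \<phi>)"
    if "bounded_lipschitz d L \<phi>" for n L \<phi>
    using that
  proof (induction n arbitrary: L \<phi>)
    case 0
    then show ?case
      using bounded_lipschitzD(2)[OF 0] close(2) r(1) contr(2) by simp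
  next
    case (Suc n)
    have "?D \<phi> \<le> ?D (kernel_mean K \<phi>) + L * c * r"
      by (rule step[OF Suc.prems])
    also have "?D (kernel_mean K \<phi>) \<le> \<kappa> * L * c * r / (1 - \<kappa>)
        + ?D ((kernel_mean K ^^ n) (kernel_mean K \<phi>))"
      by (rule Suc.IH[OF kernel_bounded_lipschitz[OF K contr(1) Suc.prems]])
    also have "\<kappa> * L * c * r / (1 - \<kappa>) + ?D ((kernel_mean K ^^ n) (kernel_mean K \<phi>)) + L * c * r
        = L * c * r / (1 - \<kappa>) + ?D ((kernel_mean K ^^ Suc n) \<phi>)"
      using contr(2) by (simp add: funpow_Suc_right field_simps del: funpow.simps)
    finally show ?case by simp
  qed
  obtain B where B: "\<And>u. \<bar>\<phi> u\<bar> \<le> B"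
    using bounded_lipschitzD(4)[OF \<phi>] by blast
  have lip: "bounded_lipschitz d (\<kappa> ^ n * L) ((kernel_mean K ^^ n) \<phi>)" for n
    by (induction n) (use \<phi> kernel_bounded_lipschitz[OF K contr(1)] in \<open>auto simp: mult.assoc\<close>)
  have bnd: "\<bar>(kernel_mean K ^^ n) \<phi> u\<bar> \<le> B" for n u
    by (induction n arbitrary: u)
       (use B kernel_mean_bounded[OF K bounded_lipschitzD(1)[OF lip]] in auto)
  have l: "(\<lambda>n. \<kappa> ^ n * L) \<longlonglongrightarrow> 0"
    using \<kappa> contr(2) by (intro tendsto_mult_left_zero LIMSEQ_power_zero) simp
  define z :: 'a where "z = undefined"
  have "(\<lambda>n. \<bar>((\<integral>u. (kernel_mean K ^^ n) \<phi> u \<partial>\<nu>) - (kernel_mean K ^^ n) \<phi> z)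
      - ((\<integral>u. (kernel_mean K ^^ n) \<phi> u \<partial>\<nu>\<^sub>0) - (kernel_mean K ^^ n) \<phi> z)\<bar>) \<longlonglongrightarrow> \<bar>0 - 0\<bar>"
    by (intro tendsto_rabs tendsto_diff vanishing_lipschitz_mean[OF _ lip l bnd] \<nu>(1) \<nu>\<^sub>0(1))
  then have "(\<lambda>n. L * c * r / (1 - \<kappa>) + ?D ((kernel_mean K ^^ n) \<phi>))
      \<longlonglongrightarrow> L * c * r / (1 - \<kappa>) + 0"
    by (intro tendsto_add tendsto_const) simp
  then have "?D \<phi> \<le> L * c * r / (1 - \<kappa>) + 0"
    by (rule Lim_bounded2) (use iter[OF \<phi>] in auto)
  then have "ennreal (?D \<phi>) \<le> ennreal (L * (c / (1 - \<kappa>)) * r)"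
    by (intro ennreal_leI) simp
  also have "\<dots> = ennreal (L * (c / (1 - \<kappa>))) * (\<integral>\<^sup>+u. f u \<partial>\<nu>\<^sub>0)"
    using bounded_lipschitzD(2)[OF \<phi>] close(2) contr(2) r(1)
    unfolding r(2) by (intro ennreal_mult) auto
  finally show ?thesis .
qed

text \<open>
  The contraction is assumed only for the perturbed kernels; the unperturbed one inherits its dual
  form because both of its integrals are limits of perturbed ones.
\<close>

lemma limit_of_contracting_kernels:
  assumes F: "F \<noteq> bot"
    and ev: "\<forall>\<^sub>F \<theta> in F. K \<theta> \<in> borel \<rightarrow>\<^sub>M prob_algebra borel \<and> wasserstein_contracting d \<kappa> (K \<theta>) \<and>
      kernels_close d (c \<theta>) f (K \<theta>) K\<^sub>0 \<and> 0 \<le> c \<theta>"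
    and c: "(c \<longlongrightarrow> 0) F" and K\<^sub>0: "K\<^sub>0 \<in> borel \<rightarrow>\<^sub>M prob_algebra borel"
    and f: "f \<in> borel_measurable borel"
    and \<mu>: "\<mu> \<in> Pr" "(\<integral>\<^sup>+u. f u \<partial>\<mu>) < \<infinity>" and \<nu>: "\<nu> \<in> Pr" "(\<integral>\<^sup>+u. f u \<partial>\<nu>) < \<infinity>"
    and \<phi>: "bounded_lipschitz d L \<phi>"
  shows "ennreal \<bar>(\<integral>u. \<phi> u \<partial>(\<mu> \<bind> K\<^sub>0)) - (\<integral>u. \<phi> u \<partial>(\<nu> \<bind> K\<^sub>0))\<bar>
    \<le> ennreal L * (ennreal \<kappa> * wasserstein d \<mu> \<nu>)" (is "?D \<le> ?W")
proof -
  define S where "S = (\<integral>\<^sup>+u. f u \<partial>\<mu>) + (\<integral>\<^sup>+u. f u \<partial>\<nu>)"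
  have L: "0 \<le> L" by (rule bounded_lipschitzD(2)[OF \<phi>])
  have "\<forall>\<^sub>F \<theta> in F. ?D \<le> ?W + S * ennreal (L * c \<theta>)"
    using ev
  proof eventually_elim
    case (elim \<theta>)
    then have K: "K \<theta> \<in> borel \<rightarrow>\<^sub>M prob_algebra borel" and contr: "wasserstein_contracting d \<kappa> (K \<theta>)"
      and close: "kernels_close d (c \<theta>) f (K \<theta>) K\<^sub>0" by auto
    let ?I = "\<lambda>m. \<integral>u. \<phi> u \<partial>m"
    note pert = kernel_perturbation[OF K K\<^sub>0 close f \<phi>]
    have "?D \<le> ennreal \<bar>?I (\<mu> \<bind> K\<^sub>0) - ?I (\<mu> \<bind> K \<theta>)\<bar>
        + ennreal \<bar>?I (\<mu> \<bind> K \<theta>) - ?I (\<nu> \<bind> K\<^sub>0)\<bar>"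
      by (rule ennreal_abs_diff_triangle)
    also have "\<dots> \<le> ennreal (L * c \<theta>) * (\<integral>\<^sup>+u. f u \<partial>\<mu>)
        + (ennreal \<bar>?I (\<mu> \<bind> K \<theta>) - ?I (\<nu> \<bind> K \<theta>)\<bar> + ennreal \<bar>?I (\<nu> \<bind> K \<theta>) - ?I (\<nu> \<bind> K\<^sub>0)\<bar>)"
      using pert[OF \<mu>(1)]
      by (intro add_mono ennreal_abs_diff_triangle) (simp add: abs_minus_commute)
    also have "\<dots> \<le> ennreal (L * c \<theta>) * (\<integral>\<^sup>+u. f u \<partial>\<mu>)
        + (?W + ennreal (L * c \<theta>) * (\<integral>\<^sup>+u. f u \<partial>\<nu>))"
    proof (intro add_mono order_refl pert \<nu>(1))
      have "ennreal \<bar>?I (\<mu> \<bind> K \<theta>) - ?I (\<nu> \<bind> K \<theta>)\<bar>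
          \<le> ennreal L * wasserstein d (\<mu> \<bind> K \<theta>) (\<nu> \<bind> K \<theta>)"
        by (intro integral_diff_le_wasserstein d_measurable \<phi> bind_Pr \<mu> \<nu> K)
      also have "\<dots> \<le> ?W"
        using contr \<mu>(1) \<nu>(1) by (intro mult_left_mono) (auto simp: wasserstein_contracting_def)
      finally show "ennreal \<bar>?I (\<mu> \<bind> K \<theta>) - ?I (\<nu> \<bind> K \<theta>)\<bar> \<le> ?W" .
    qed
    also have "\<dots> = ?W + S * ennreal (L * c \<theta>)"
      by (simp add: S_def algebra_simps)
    finally show ?case .
  qed
  moreover have "((\<lambda>\<theta>. ?W + S * ennreal (L * c \<theta>)) \<longlongrightarrow> ?W + S * ennreal (L * 0)) F"
    using \<mu>(2) \<nu>(2)
    by (intro tendsto_add tendsto_const ennreal_tendsto_cmult tendsto_ennrealI tendsto_mult c)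
       (simp add: S_def)
  ultimately have "?D \<le> ?W + S * ennreal (L * 0)"
    by (intro tendsto_lowerbound[OF _ _ F])
  then show ?thesis by simp
qed

text \<open>
  The comparison takes four steps: from \<open>\<mu> K\<close> to \<open>\<nu>\<^sub>0 K\<close> by
  contraction, from \<open>\<nu>\<^sub>0 K\<close> to \<open>\<nu> = \<nu> K\<close> by closeness of the invariant measures applied to
  the shrunken test function \<open>K \<phi>\<close>, from \<open>\<nu>\<close> to \<open>\<nu>\<^sub>0\<close> by the same closeness, and from
  \<open>\<nu>\<^sub>0 = \<nu>\<^sub>0 K\<^sub>0\<close> to \<open>\<mu> K\<^sub>0\<close> by the contraction of the unperturbed kernel. This detour
  avoids the perturbation bound for this pair of kernels, whose time factor may grow.
\<close>

lemma long_time_bound: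
  assumes K: "K \<in> borel \<rightarrow>\<^sub>M prob_algebra borel" and K\<^sub>0: "K\<^sub>0 \<in> borel \<rightarrow>\<^sub>M prob_algebra borel"
    and contr: "wasserstein_contracting d \<kappa> K"
    and contr\<^sub>0: "ennreal \<bar>(\<integral>u. \<phi> u \<partial>(\<mu> \<bind> K\<^sub>0)) - (\<integral>u. \<phi> u \<partial>(\<nu>\<^sub>0 \<bind> K\<^sub>0))\<bar>
      \<le> ennreal L * (ennreal \<kappa> * wasserstein d \<mu> \<nu>\<^sub>0)"
    and \<mu>: "\<mu> \<in> Pr"
    and \<nu>: "\<nu> \<in> Pr" "\<nu> \<bind> K = \<nu>" and \<nu>\<^sub>0: "\<nu>\<^sub>0 \<in> Pr" "\<nu>\<^sub>0 \<bind> K\<^sub>0 = \<nu>\<^sub>0"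
    and inv: "\<And>L \<phi>. bounded_lipschitz d L \<phi> \<Longrightarrow>
      ennreal \<bar>(\<integral>u. \<phi> u \<partial>\<nu>) - (\<integral>u. \<phi> u \<partial>\<nu>\<^sub>0)\<bar> \<le> ennreal (L * e) * S"
    and e: "0 \<le> e"
    and \<phi>: "bounded_lipschitz d L \<phi>"
  shows "ennreal \<bar>(\<integral>u. \<phi> u \<partial>(\<mu> \<bind> K)) - (\<integral>u. \<phi> u \<partial>(\<mu> \<bind> K\<^sub>0))\<bar>
    \<le> ennreal L * (ennreal (2 * \<kappa>) * wasserstein d \<mu> \<nu>\<^sub>0 + ennreal ((1 + \<kappa>) * e) * S)"
proof -
  let ?I = "\<lambda>m. \<integral>u. \<phi> u \<partial>m" and ?W = "ennreal L * (ennreal \<kappa> * wasserstein d \<mu> \<nu>\<^sub>0)"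
  have \<kappa>: "0 \<le> \<kappa>" using contr by (simp add: wasserstein_contracting_def)
  have L: "0 \<le> L" by (rule bounded_lipschitzD(2)[OF \<phi>])
  obtain B where B: "\<And>u. \<bar>\<phi> u\<bar> \<le> B"
    using bounded_lipschitzD(4)[OF \<phi>] by blast
  note mean = integral_bind_kernel[OF K bounded_lipschitzD(1)[OF \<phi>] B]
  have 1: "ennreal \<bar>?I (\<mu> \<bind> K) - ?I (\<nu>\<^sub>0 \<bind> K)\<bar> \<le> ?W"
  proof -
    have "ennreal \<bar>?I (\<mu> \<bind> K) - ?I (\<nu>\<^sub>0 \<bind> K)\<bar> \<le> ennreal L * wasserstein d (\<mu> \<bind> K) (\<nu>\<^sub>0 \<bind> K)"
      by (intro integral_diff_le_wasserstein d_measurable \<phi> bind_Pr \<mu> \<nu>\<^sub>0 K)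
    also have "\<dots> \<le> ?W"
      using contr \<mu> \<nu>\<^sub>0(1) by (intro mult_left_mono) (auto simp: wasserstein_contracting_def)
    finally show ?thesis .
  qed
  have 2: "ennreal \<bar>?I (\<nu>\<^sub>0 \<bind> K) - ?I \<nu>\<bar> \<le> ennreal (\<kappa> * L * e) * S"
    using inv[OF kernel_bounded_lipschitz[OF K contr \<phi>]] mean[OF \<nu>(1)] mean[OF \<nu>\<^sub>0(1)] \<nu>(2)
    by (simp add: abs_minus_commute)
  have 3: "ennreal \<bar>?I \<nu> - ?I \<nu>\<^sub>0\<bar> \<le> ennreal (L * e) * S"
    by (rule inv[OF \<phi>])
  have 4: "ennreal \<bar>?I \<nu>\<^sub>0 - ?I (\<mu> \<bind> K\<^sub>0)\<bar> \<le> ?W"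
    using contr\<^sub>0 \<nu>\<^sub>0(2) by (simp add: abs_minus_commute)
  have "ennreal \<bar>?I (\<mu> \<bind> K) - ?I (\<mu> \<bind> K\<^sub>0)\<bar>
      \<le> ennreal \<bar>?I (\<mu> \<bind> K) - ?I (\<nu>\<^sub>0 \<bind> K)\<bar> + (ennreal \<bar>?I (\<nu>\<^sub>0 \<bind> K) - ?I \<nu>\<bar>
        + (ennreal \<bar>?I \<nu> - ?I \<nu>\<^sub>0\<bar> + ennreal \<bar>?I \<nu>\<^sub>0 - ?I (\<mu> \<bind> K\<^sub>0)\<bar>))"
    by (auto simp flip: ennreal_plus intro!: ennreal_leI)
  also have "\<dots> \<le> ?W + (ennreal (\<kappa> * L * e) * S + (ennreal (L * e) * S + ?W))"
    by (intro add_mono 1 2 3 4)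
  also have "\<dots> = ennreal L * (ennreal (2 * \<kappa>) * wasserstein d \<mu> \<nu>\<^sub>0 + ennreal ((1 + \<kappa>) * e) * S)"
  proof -
    have "ennreal (\<kappa> * L * e) = ennreal L * (ennreal \<kappa> * ennreal e)"
      "ennreal (L * e) = ennreal L * ennreal e" "ennreal (2 * \<kappa>) = 2 * ennreal \<kappa>"
      "ennreal ((1 + \<kappa>) * e) = ennreal e + ennreal \<kappa> * ennreal e"
      using L \<kappa> e by (simp_all add: mult_ac distrib_left flip: ennreal_mult ennreal_plus)
         (simp add: ennreal_mult')
    then show ?thesis by (simp add: algebra_simps mult_2)
  qed
  finally show ?thesis .
qed

end

section \<open>Bounds uniform in time\<close>

lemma exp_decay:
  fixes c :: real
  assumes "0 < c"
  shows "((\<lambda>t. exp (- t * c)) \<longlongrightarrow> 0) at_top"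
  using assms
  by (intro filterlim_compose[OF exp_at_bot])
     (simp add: filterlim_uminus_at_bot filterlim_at_top_mult_tendsto_pos[OF tendsto_const _ filterlim_ident])

text \<open>
  The distance \<open>d\<close> stands for a single \<open>\<rho>\<^sub>\<alpha>\<close>, which is possible because the contraction is used with
  \<open>m = 1\<close>, where both of its sides carry the same weight.
\<close>

locale perturbed_contraction =
  fixes d :: "'a::topological_space \<Rightarrow> 'a \<Rightarrow> real"
    and \<Theta> :: "'p::topological_space set" and \<theta>\<^sub>0 :: 'p
    and P :: "'p \<Rightarrow> real \<Rightarrow> 'a \<Rightarrow> 'a measure" and \<mu> :: "'p \<Rightarrow> 'a measure"
    and R :: "real \<Rightarrow> real" and g :: "'p \<Rightarrow> real" and f :: "'a \<Rightarrow> ennreal"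
    and T C1 C2 :: real
  assumes d_measurable: "(\<lambda>z. d (fst z) (snd z)) \<in> borel_measurable borel"
    and d_nonneg: "\<And>u v. 0 \<le> d u v"
    and kernel: "\<And>\<theta> t. \<theta> \<in> \<Theta> \<Longrightarrow> 0 \<le> t \<Longrightarrow> P \<theta> t \<in> borel \<rightarrow>\<^sub>M prob_algebra borel"
    and inv_Pr: "\<And>\<theta>. \<theta> \<in> \<Theta> \<Longrightarrow> \<mu> \<theta> \<in> Pr"
    and inv: "\<And>\<theta> t. \<theta> \<in> \<Theta> \<Longrightarrow> 0 \<le> t \<Longrightarrow> \<mu> \<theta> \<bind> P \<theta> t = \<mu> \<theta>"
    and theta0: "\<theta>\<^sub>0 \<in> \<Theta>" "\<theta>\<^sub>0 islimpt \<Theta>"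
    and g_nonneg: "\<And>\<theta>. \<theta> \<in> \<Theta> \<Longrightarrow> 0 \<le> g \<theta>" and g_lim: "(g \<longlongrightarrow> 0) (at \<theta>\<^sub>0 within \<Theta>)"
    and R_nonneg: "\<And>t. 0 \<le> t \<Longrightarrow> 0 \<le> R t" and R_mono: "mono_on {0..} R"
    and f_measurable: "f \<in> borel_measurable borel"
    and f_int: "(\<integral>\<^sup>+u. f u \<partial>\<mu> \<theta>\<^sub>0) < \<infinity>"
    and close: "\<And>\<theta> t. \<theta> \<in> \<Theta> \<Longrightarrow> 0 \<le> t \<Longrightarrow> kernels_close d (R t * g \<theta>) f (P \<theta> t) (P \<theta>\<^sub>0 t)"
    and T: "0 \<le> T" and C: "0 < C1" "0 < C2"
    and contr: "\<And>\<theta> t. \<theta> \<in> \<Theta> - {\<theta>\<^sub>0} \<Longrightarrow> T \<le> t \<Longrightarrow>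
      wasserstein_contracting d (C1 * exp (- t * C2)) (P \<theta> t)"
begin

lemma bind_return_kernel: "\<theta> \<in> \<Theta> \<Longrightarrow> 0 \<le> t \<Longrightarrow> return borel u \<bind> P \<theta> t = P \<theta> t u"
  by (rule bind_return[OF measurable_prob_algebraD[OF kernel]]) auto

lemma short_time:
  assumes \<theta>: "\<theta> \<in> \<Theta>" and t: "0 \<le> t" and \<phi>: "bounded_lipschitz d L \<phi>"
  shows "ennreal \<bar>(\<integral>u. \<phi> u \<partial>P \<theta> t u\<^sub>0) - (\<integral>u. \<phi> u \<partial>P \<theta>\<^sub>0 t u\<^sub>0)\<bar>
    \<le> ennreal L * (ennreal (R t * g \<theta>) * f u\<^sub>0)"
  using kernel_perturbation[OF d_measurable d_nonneg kernel[OF \<theta> t] kernel[OF theta0(1) t]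
      close[OF \<theta> t] f_measurable \<phi> return_Pr[of u\<^sub>0]] bounded_lipschitzD(2)[OF \<phi>]
  by (simp add: bind_return_kernel \<theta> theta0(1) t nn_integral_return f_measurable ennreal_mult'
      mult.assoc)

text \<open>
  A time \<open>t\<close> with \<open>C1 * exp (- t * C2) < 1\<close> is fixed once and for all, so that \<open>e\<close> does not
  depend on \<open>\<theta>\<close>.
\<close>

lemma invariant_measures:
  "\<exists>e\<ge>0. \<forall>\<theta>\<in>\<Theta> - {\<theta>\<^sub>0}. \<forall>L \<phi>. bounded_lipschitz d L \<phi> \<longrightarrow>
     ennreal \<bar>(\<integral>u. \<phi> u \<partial>\<mu> \<theta>) - (\<integral>u. \<phi> u \<partial>\<mu> \<theta>\<^sub>0)\<bar> \<le> ennreal (L * (e * g \<theta>)) * (\<integral>\<^sup>+u. f u \<partial>\<mu> \<theta>\<^sub>0)"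
proof -
  have "((\<lambda>t. C1 * exp (- t * C2)) \<longlongrightarrow> C1 * 0) at_top"
    by (intro tendsto_intros exp_decay C)
  then have "\<forall>\<^sub>F t in at_top. C1 * exp (- t * C2) < 1"
    by (rule order_tendstoD) simp
  then have "\<forall>\<^sub>F t in at_top. C1 * exp (- t * C2) < 1 \<and> T \<le> t"
    by (rule eventually_conj) (rule eventually_ge_at_top)
  then obtain t where t: "C1 * exp (- t * C2) < 1" "T \<le> t"
    using eventually_happens by fastforce
  then have t0: "0 \<le> t" using T by simp
  let ?e = "R t / (1 - C1 * exp (- t * C2))"
  show ?thesis
  proof (intro exI[of _ ?e] conjI ballI allI impI)
    show "0 \<le> ?e" using t R_nonneg[OF t0] by simp
    fix \<theta> L \<phi> assume \<theta>: "\<theta> \<in> \<Theta> - {\<theta>\<^sub>0}" and \<phi>: "bounded_lipschitz d L \<phi>"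
    then have \<theta>': "\<theta> \<in> \<Theta>" by simp
    show "ennreal \<bar>(\<integral>u. \<phi> u \<partial>\<mu> \<theta>) - (\<integral>u. \<phi> u \<partial>\<mu> \<theta>\<^sub>0)\<bar>
        \<le> ennreal (L * (?e * g \<theta>)) * (\<integral>\<^sup>+u. f u \<partial>\<mu> \<theta>\<^sub>0)"
      using invariant_measures_close[OF d_measurable d_nonneg kernel[OF \<theta>' t0] kernel[OF theta0(1) t0]
          contr[OF \<theta> t(2)] t(1) close[OF \<theta>' t0] _ f_measurable inv_Pr[OF \<theta>'] inv[OF \<theta>' t0]
          inv_Pr[OF theta0(1)] inv[OF theta0(1) t0] f_int \<phi>] R_nonneg[OF t0] g_nonneg[OF \<theta>']
      by simp
  qed
qed

text \<open>
  The limit is taken along \<open>\<theta> \<rightarrow> \<theta>\<^sub>0\<close> at the fixed time \<open>t\<close>, so the possible growth of \<open>R\<close> is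
  harmless.
\<close>

lemma contraction_at_limit:
  assumes u: "f u\<^sub>0 < \<infinity>" and t: "T \<le> t" and \<phi>: "bounded_lipschitz d L \<phi>"
  shows "ennreal \<bar>(\<integral>u. \<phi> u \<partial>(return borel u\<^sub>0 \<bind> P \<theta>\<^sub>0 t)) - (\<integral>u. \<phi> u \<partial>(\<mu> \<theta>\<^sub>0 \<bind> P \<theta>\<^sub>0 t))\<bar>
    \<le> ennreal L * (ennreal (C1 * exp (- t * C2)) * wasserstein d (return borel u\<^sub>0) (\<mu> \<theta>\<^sub>0))"
proof (rule limit_of_contracting_kernels[OF d_measurable d_nonneg, where F="at \<theta>\<^sub>0 within \<Theta>"
      and K="\<lambda>\<theta>. P \<theta> t" and c="\<lambda>\<theta>. R t * g \<theta>" and f=f])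
  have t0: "0 \<le> t" using T t by simp
  show "at \<theta>\<^sub>0 within \<Theta> \<noteq> bot"
    using theta0(2) trivial_limit_within by blast
  have "\<forall>\<^sub>F \<theta> in at \<theta>\<^sub>0 within \<Theta>. \<theta> \<in> \<Theta> - {\<theta>\<^sub>0}"
    by (simp add: eventually_at_filter)
  then show "\<forall>\<^sub>F \<theta> in at \<theta>\<^sub>0 within \<Theta>. P \<theta> t \<in> borel \<rightarrow>\<^sub>M prob_algebra borel \<and>
      wasserstein_contracting d (C1 * exp (- t * C2)) (P \<theta> t) \<and>
      kernels_close d (R t * g \<theta>) f (P \<theta> t) (P \<theta>\<^sub>0 t) \<and> 0 \<le> R t * g \<theta>"
    by eventually_elim (use kernel contr close t t0 R_nonneg g_nonneg in auto)
  show "((\<lambda>\<theta>. R t * g \<theta>) \<longlongrightarrow> 0) (at \<theta>\<^sub>0 within \<Theta>)"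
    using tendsto_mult_right[OF g_lim, of "R t"] tendsto_mult_left[OF g_lim, of "R t"] by simp
  show "(\<integral>\<^sup>+u. f u \<partial>return borel u\<^sub>0) < \<infinity>"
    using u f_measurable by (simp add: nn_integral_return)
qed (use kernel theta0 t T f_measurable inv_Pr f_int return_Pr \<phi> in auto)

lemma long_time:
  "\<exists>k\<ge>0. \<forall>\<theta>\<in>\<Theta> - {\<theta>\<^sub>0}. \<forall>u\<^sub>0 L \<phi> t. f u\<^sub>0 < \<infinity> \<and> T \<le> t \<and> bounded_lipschitz d L \<phi> \<longrightarrow>
     ennreal \<bar>(\<integral>u. \<phi> u \<partial>P \<theta> t u\<^sub>0) - (\<integral>u. \<phi> u \<partial>P \<theta>\<^sub>0 t u\<^sub>0)\<bar>
     \<le> ennreal L * (ennreal (2 * C1 * exp (- t * C2)) * wasserstein d (return borel u\<^sub>0) (\<mu> \<theta>\<^sub>0)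
          + ennreal (k * g \<theta>) * (\<integral>\<^sup>+u. f u \<partial>\<mu> \<theta>\<^sub>0))"
proof -
  obtain e where e: "0 \<le> e" "\<And>\<theta> L \<phi>. \<theta> \<in> \<Theta> - {\<theta>\<^sub>0} \<Longrightarrow> bounded_lipschitz d L \<phi> \<Longrightarrow>
     ennreal \<bar>(\<integral>u. \<phi> u \<partial>\<mu> \<theta>) - (\<integral>u. \<phi> u \<partial>\<mu> \<theta>\<^sub>0)\<bar>
       \<le> ennreal (L * (e * g \<theta>)) * (\<integral>\<^sup>+u. f u \<partial>\<mu> \<theta>\<^sub>0)"
    using invariant_measures by blast
  show ?thesis
  proof (intro exI[of _ "(1 + C1) * e"] conjI ballI allI impI)
    show "0 \<le> (1 + C1) * e" using C e(1) by simp
    fix \<theta> u\<^sub>0 L \<phi> t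
    assume \<theta>: "\<theta> \<in> \<Theta> - {\<theta>\<^sub>0}" and "f u\<^sub>0 < \<infinity> \<and> T \<le> t \<and> bounded_lipschitz d L \<phi>"
    then have u: "f u\<^sub>0 < \<infinity>" and t: "T \<le> t" "0 \<le> t" and \<phi>: "bounded_lipschitz d L \<phi>"
      and \<theta>': "\<theta> \<in> \<Theta>"
      using T by auto
    let ?\<kappa> = "C1 * exp (- t * C2)"
    have \<kappa>: "?\<kappa> \<le> C1"
      using C t(2) by simp
    have "ennreal \<bar>(\<integral>u. \<phi> u \<partial>P \<theta> t u\<^sub>0) - (\<integral>u. \<phi> u \<partial>P \<theta>\<^sub>0 t u\<^sub>0)\<bar>
        \<le> ennreal L * (ennreal (2 * ?\<kappa>) * wasserstein d (return borel u\<^sub>0) (\<mu> \<theta>\<^sub>0)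
          + ennreal ((1 + ?\<kappa>) * (e * g \<theta>)) * (\<integral>\<^sup>+u. f u \<partial>\<mu> \<theta>\<^sub>0))"
      using long_time_bound[OF d_measurable d_nonneg kernel[OF \<theta>' t(2)] kernel[OF theta0(1) t(2)]
          contr[OF \<theta> t(1)] contraction_at_limit[OF u t(1) \<phi>] return_Pr inv_Pr[OF \<theta>'] inv[OF \<theta>' t(2)]
          inv_Pr[OF theta0(1)] inv[OF theta0(1) t(2)] e(2)[OF \<theta>] _ \<phi>] e(1) g_nonneg[OF \<theta>']
      by (simp add: bind_return_kernel \<theta>' theta0(1) t(2))
    also have "\<dots> \<le> ennreal L * (ennreal (2 * C1 * exp (- t * C2)) * wasserstein d (return borel u\<^sub>0) (\<mu> \<theta>\<^sub>0)
          + ennreal ((1 + C1) * e * g \<theta>) * (\<integral>\<^sup>+u. f u \<partial>\<mu> \<theta>\<^sub>0))"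
    proof (intro mult_left_mono add_mono mult_right_mono ennreal_leI)
      have "(1 + ?\<kappa>) * (e * g \<theta>) \<le> (1 + C1) * (e * g \<theta>)"
        using \<kappa> e(1) g_nonneg[OF \<theta>'] by (intro mult_right_mono) auto
      then show "(1 + ?\<kappa>) * (e * g \<theta>) \<le> (1 + C1) * e * g \<theta>" by (simp only: mult.assoc)
    qed auto
    finally show "ennreal \<bar>(\<integral>u. \<phi> u \<partial>P \<theta> t u\<^sub>0) - (\<integral>u. \<phi> u \<partial>P \<theta>\<^sub>0 t u\<^sub>0)\<bar>
       \<le> ennreal L * (ennreal (2 * C1 * exp (- t * C2)) * wasserstein d (return borel u\<^sub>0) (\<mu> \<theta>\<^sub>0)
          + ennreal ((1 + C1) * e * g \<theta>) * (\<integral>\<^sup>+u. f u \<partial>\<mu> \<theta>\<^sub>0))" .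
  qed
qed

text \<open>
  The free threshold \<open>\<tau>\<close> separates the two regimes: up to \<open>\<tau>\<close> monotonicity of \<open>R\<close> bounds the
  perturbation error, and beyond \<open>\<tau>\<close> the exponential decay bounds the memory of the initial point.
\<close>

lemma all_times:
  "\<exists>k\<ge>0. \<forall>\<theta>\<in>\<Theta> - {\<theta>\<^sub>0}. \<forall>u\<^sub>0 L \<phi> t \<tau>. f u\<^sub>0 < \<infinity> \<and> 0 \<le> t \<and> T \<le> \<tau> \<and> bounded_lipschitz d L \<phi> \<longrightarrow>
     ennreal \<bar>(\<integral>u. \<phi> u \<partial>P \<theta> t u\<^sub>0) - (\<integral>u. \<phi> u \<partial>P \<theta>\<^sub>0 t u\<^sub>0)\<bar>
     \<le> ennreal L * (ennreal (2 * C1 * exp (- \<tau> * C2)) * wasserstein d (return borel u\<^sub>0) (\<mu> \<theta>\<^sub>0)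
          + ennreal (R \<tau> * g \<theta>) * f u\<^sub>0 + ennreal (k * g \<theta>) * (\<integral>\<^sup>+u. f u \<partial>\<mu> \<theta>\<^sub>0))"
proof -
  obtain k where k: "0 \<le> k" "\<And>\<theta> u\<^sub>0 L \<phi> t. \<theta> \<in> \<Theta> - {\<theta>\<^sub>0} \<Longrightarrow> f u\<^sub>0 < \<infinity> \<Longrightarrow> T \<le> t \<Longrightarrow>
     bounded_lipschitz d L \<phi> \<Longrightarrow>
     ennreal \<bar>(\<integral>u. \<phi> u \<partial>P \<theta> t u\<^sub>0) - (\<integral>u. \<phi> u \<partial>P \<theta>\<^sub>0 t u\<^sub>0)\<bar>
     \<le> ennreal L * (ennreal (2 * C1 * exp (- t * C2)) * wasserstein d (return borel u\<^sub>0) (\<mu> \<theta>\<^sub>0)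
          + ennreal (k * g \<theta>) * (\<integral>\<^sup>+u. f u \<partial>\<mu> \<theta>\<^sub>0))"
    using long_time by blast
  show ?thesis
  proof (intro exI[of _ k] conjI ballI allI impI)
    fix \<theta> u\<^sub>0 L \<phi> and t \<tau> :: real
    assume \<theta>: "\<theta> \<in> \<Theta> - {\<theta>\<^sub>0}" and "f u\<^sub>0 < \<infinity> \<and> 0 \<le> t \<and> T \<le> \<tau> \<and> bounded_lipschitz d L \<phi>"
    then have u: "f u\<^sub>0 < \<infinity>" and t: "0 \<le> t" and \<tau>: "T \<le> \<tau>" and \<phi>: "bounded_lipschitz d L \<phi>"
      and \<theta>': "\<theta> \<in> \<Theta>"
      by auto
    let ?W = "wasserstein d (return borel u\<^sub>0) (\<mu> \<theta>\<^sub>0)" and ?F = "\<integral>\<^sup>+u. f u \<partial>\<mu> \<theta>\<^sub>0"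
    let ?D = "ennreal \<bar>(\<integral>u. \<phi> u \<partial>P \<theta> t u\<^sub>0) - (\<integral>u. \<phi> u \<partial>P \<theta>\<^sub>0 t u\<^sub>0)\<bar>"
    show "?D \<le> ennreal L * (ennreal (2 * C1 * exp (- \<tau> * C2)) * ?W
        + ennreal (R \<tau> * g \<theta>) * f u\<^sub>0 + ennreal (k * g \<theta>) * ?F)"
    proof (cases "t \<le> \<tau>")
      case True
      have "?D \<le> ennreal L * (ennreal (R t * g \<theta>) * f u\<^sub>0)"
        by (rule short_time[OF \<theta>' t \<phi>])
      also have "\<dots> \<le> ennreal L * (ennreal (R \<tau> * g \<theta>) * f u\<^sub>0)"
        using mono_onD[OF R_mono _ _ True] t True g_nonneg[OF \<theta>']
        by (intro mult_left_mono mult_right_mono ennreal_leI) auto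
      also have "\<dots> \<le> ennreal L * (ennreal (2 * C1 * exp (- \<tau> * C2)) * ?W
          + ennreal (R \<tau> * g \<theta>) * f u\<^sub>0 + ennreal (k * g \<theta>) * ?F)"
        by (intro mult_left_mono add_increasing2 add_increasing) auto
      finally show ?thesis .
    next
      case False
      then have "\<tau> * C2 \<le> t * C2"
        using C by (intro mult_right_mono) auto
      then have "ennreal (2 * C1 * exp (- t * C2)) \<le> ennreal (2 * C1 * exp (- \<tau> * C2))"
        using C by (intro ennreal_leI) simp
      then have decay: "ennreal (2 * C1 * exp (- t * C2)) * ?W
          \<le> ennreal (2 * C1 * exp (- \<tau> * C2)) * ?W + ennreal (R \<tau> * g \<theta>) * f u\<^sub>0"
        by (intro add_increasing2 mult_right_mono) auto
      have "?D \<le> ennreal L * (ennreal (2 * C1 * exp (- t * C2)) * ?W + ennreal (k * g \<theta>) * ?F)"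
        using \<tau> False by (intro k(2)[OF \<theta> u _ \<phi>]) simp
      also have "\<dots> \<le> ennreal L * ((ennreal (2 * C1 * exp (- \<tau> * C2)) * ?W
          + ennreal (R \<tau> * g \<theta>) * f u\<^sub>0) + ennreal (k * g \<theta>) * ?F)"
        by (rule mult_left_mono[OF add_right_mono[OF decay]]) simp
      finally show ?thesis .
    qed
  qed (rule k(1))
qed

end

section \<open>The rate of convergence\<close>

lemma contraction_imp_wasserstein_contracting:
  assumes "contraction I P \<rho> 1 \<alpha> T C1 C2" "\<theta> \<in> I" "T \<le> t" "0 \<le> C1"
  shows "wasserstein_contracting (weighted \<rho> \<alpha>) (C1 * exp (- t * C2)) (P \<theta> t)"
  unfolding wasserstein_contracting_def
proof (intro conjI ballI)
  fix \<mu> \<nu> :: "'b measure" assume "\<mu> \<in> Pr" "\<nu> \<in> Pr"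
  then have "(SUP \<theta>\<in>I. wasserstein (weighted \<rho> \<alpha>) (\<mu> \<bind> P \<theta> t) (\<nu> \<bind> P \<theta> t))
      \<le> ennreal (C1 * exp (- t * C2)) * wasserstein (weighted \<rho> \<alpha>) \<mu> \<nu>"
    using assms(1,3) unfolding contraction_def by fastforce
  then show "wasserstein (weighted \<rho> \<alpha>) (\<mu> \<bind> P \<theta> t) (\<nu> \<bind> P \<theta> t)
      \<le> ennreal (C1 * exp (- t * C2)) * wasserstein (weighted \<rho> \<alpha>) \<mu> \<nu>"
    using assms(2) by (meson SUP_upper order_trans)
qed (use assms(4) in simp)

text \<open>
  Here \<open>\<tau>\<close> is the time at which the short-time estimate hands over to the long-time one: solving
  \<open>R \<tau> = C x\<^sup>-\<^sup>q\<close> makes the short-time error \<open>R \<tau> * x\<close> equal to \<open>C x\<^sup>1\<^sup>-\<^sup>q\<close>. The intermediate value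
  theorem provides a solution with \<open>\<tau> \<ge> T\<close> once the target is at least \<open>R T\<close>.
\<close>

lemma rate_choice:
  fixes R :: "real \<Rightarrow> real"
  assumes cont: "continuous_on {0..} R" and mono: "strict_mono_on {0..} R"
    and nonneg: "\<And>t. 0 \<le> t \<Longrightarrow> 0 \<le> R t" and unbounded: "\<not> bounded (R ` {0..})"
    and T: "0 \<le> T" and q: "0 < q" and A: "0 < A" and G: "0 \<le> G"
  shows "\<exists>C>0. \<forall>x. 0 < x \<and> x \<le> G \<longrightarrow> C * x powr (- q) \<in> R ` {0..} \<and>
    (\<exists>\<tau>\<ge>T. A * exp (- \<tau> * C2) \<le> g_tilde R C C2 q x \<and> R \<tau> * x \<le> g_tilde R C C2 q x
      \<and> A * x \<le> g_tilde R C C2 q x)"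
proof -
  \<comment> \<open>The second summand gives \<open>R T \<le> C x\<^sup>-\<^sup>q\<close> for all \<open>x \<le> G\<close>.\<close>
  define C where "C = A + R T * G powr q"
  have RT: "0 \<le> R T * G powr q"
    using nonneg[OF T] by simp
  have C: "0 < C"
    unfolding C_def using RT A by linarith
  have AC: "A \<le> C"
    unfolding C_def using RT by linarith
  have "C * x powr (- q) \<in> R ` {0..} \<and> (\<exists>\<tau>\<ge>T. A * exp (- \<tau> * C2) \<le> g_tilde R C C2 q x \<and>
      R \<tau> * x \<le> g_tilde R C C2 q x \<and> A * x \<le> g_tilde R C C2 q x)"
    if x: "0 < x" "x \<le> G" for x
  proof
    define y where "y = C * x powr (- q)"
    have "R T * 1 \<le> R T * (G powr q * x powr (- q))"
    proof (rule mult_left_mono)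
      have "1 = x powr q * x powr (- q)"
        using x(1) by (simp flip: powr_add)
      also have "\<dots> \<le> G powr q * x powr (- q)"
        using x q by (intro mult_right_mono powr_mono2) auto
      finally show "1 \<le> G powr q * x powr (- q)" .
    qed (use nonneg[OF T] in simp)
    also have "\<dots> \<le> y"
      using A by (simp add: y_def C_def algebra_simps)
    finally have lower: "R T \<le> y" by simp
    have "\<exists>s\<ge>0. y < R s"
    proof (rule ccontr)
      assume "\<not> (\<exists>s\<ge>0. y < R s)"
      then have "bounded (R ` {0..})"
        using nonneg by (auto simp: bounded_iff not_less intro!: exI[of _ y])
      then show False using unbounded by simp
    qed
    then obtain s where s: "0 \<le> s" "y < R s" by blast
    have "T \<le> s"
    proof (rule ccontr)
      assume "\<not> T \<le> s"
      then have "R s < R T"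
        using s(1) T mono by (intro strict_mono_onD[OF mono]) auto
      then show False using lower s(2) by simp
    qed
    then obtain \<tau> where \<tau>: "T \<le> \<tau>" "R \<tau> = y"
      using IVT'[of R T y s] lower s(2) continuous_on_subset[OF cont, of "{T..s}"] T by auto
    then show "C * x powr (- q) \<in> R ` {0..}"
      using T by (force simp: y_def)
    have inv: "the_inv_into {0..} R (C * x powr (- q)) = \<tau>"
      using \<tau> T strict_mono_on_imp_inj_on[OF mono] by (intro the_inv_into_f_eq) (auto simp: y_def)
    define m where "m = Max {exp (- C2 * \<tau>), x, x powr (1 - q)}"
    have m: "exp (- \<tau> * C2) \<le> m" "x \<le> m" "x powr (1 - q) \<le> m"
      by (auto simp: m_def mult.commute)
    have gt: "g_tilde R C C2 q x = C * m"
      using unbounded x(1) inv by (simp add: g_tilde_def m_def)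
    show "\<exists>\<tau>\<ge>T. A * exp (- \<tau> * C2) \<le> g_tilde R C C2 q x \<and> R \<tau> * x \<le> g_tilde R C C2 q x
        \<and> A * x \<le> g_tilde R C C2 q x"
    proof (intro exI conjI)
      show "T \<le> \<tau>" by (rule \<tau>(1))
      show "A * exp (- \<tau> * C2) \<le> g_tilde R C C2 q x"
        unfolding gt using AC A m(1) by (intro mult_mono) auto
      show "A * x \<le> g_tilde R C C2 q x"
        unfolding gt using AC A m(2) x(1) by (intro mult_mono) auto
      have "R \<tau> * x = C * (x powr (- q) * x powr 1)"
        using x(1) by (simp add: \<tau>(2) y_def)
      also have "\<dots> = C * x powr (1 - q)"
        unfolding powr_add[symmetric] by simp
      also have "\<dots> \<le> C * m"
        using C m(3) by simp
      finally show "R \<tau> * x \<le> g_tilde R C C2 q x" unfolding gt .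
    qed
  qed
  then show ?thesis
    using C by blast
qed

theorem corollary2p8:
  fixes \<Lambda> :: "('a::{banach, second_countable_topology} \<Rightarrow> 'a \<Rightarrow> real) set"
    and \<Theta> :: "'p::topological_space set" and \<theta>\<^sub>0 :: 'p
    and P :: "'p \<Rightarrow> real \<Rightarrow> 'a \<Rightarrow> 'a measure"
    and \<mu> :: "'p \<Rightarrow> 'a measure"
    and \<gamma> \<alpha>' :: real
    and R :: "real \<Rightarrow> ('a \<Rightarrow> 'a \<Rightarrow> real) \<Rightarrow> real \<Rightarrow> real"
    and g :: "real \<Rightarrow> ('a \<Rightarrow> 'a \<Rightarrow> real) \<Rightarrow> 'p \<Rightarrow> real"
    and f :: "real \<Rightarrow> ('a \<Rightarrow> 'a \<Rightarrow> real) \<Rightarrow> 'a \<Rightarrow> ennreal"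
    and M :: "'w measure"
    and U :: "'p \<Rightarrow> 'a \<Rightarrow> real \<Rightarrow> 'w \<Rightarrow> 'a"
  assumes Lambda: "\<And>\<rho>. \<rho> \<in> \<Lambda> \<Longrightarrow> distance_like \<rho> \<and> (\<forall>u v. \<rho> u v \<le> 1)"
    and kernel: "\<And>\<theta> t. \<theta> \<in> \<Theta> \<Longrightarrow> 0 \<le> t \<Longrightarrow> P \<theta> t \<in> borel \<rightarrow>\<^sub>M prob_algebra borel"
    and H1: "1 \<le> \<gamma>"
      "\<And>\<rho> \<alpha>. \<rho> \<in> \<Lambda> \<Longrightarrow> 0 < \<alpha> \<Longrightarrow>
         \<exists>C>0. \<forall>u v w. weighted \<rho> \<alpha> u v
                 \<le> C * (weighted \<rho> (\<gamma> * \<alpha>) u w + weighted \<rho> (\<gamma> * \<alpha>) w v)"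
    and H2: "\<And>\<theta>. \<theta> \<in> \<Theta> \<Longrightarrow> \<mu> \<theta> \<in> Pr"
      "\<And>\<theta> t. \<theta> \<in> \<Theta> \<Longrightarrow> 0 \<le> t \<Longrightarrow> \<mu> \<theta> \<bind> P \<theta> t = \<mu> \<theta>"
    and theta0: "\<theta>\<^sub>0 \<in> \<Theta>" "\<theta>\<^sub>0 islimpt \<Theta>"
    and H3: "0 < \<alpha>'"
      "\<And>\<alpha> \<rho> \<theta>. 0 < \<alpha> \<Longrightarrow> \<alpha> \<le> \<alpha>' \<Longrightarrow> \<rho> \<in> \<Lambda> \<Longrightarrow> \<theta> \<in> \<Theta> \<Longrightarrow> 0 \<le> g \<alpha> \<rho> \<theta>"
      "\<And>\<alpha> \<rho> t. 0 < \<alpha> \<Longrightarrow> \<alpha> \<le> \<alpha>' \<Longrightarrow> \<rho> \<in> \<Lambda> \<Longrightarrow> 0 \<le> t \<Longrightarrow> 0 \<le> R \<alpha> \<rho> t"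
      "\<And>\<alpha> \<rho>. 0 < \<alpha> \<Longrightarrow> \<alpha> \<le> \<alpha>' \<Longrightarrow> \<rho> \<in> \<Lambda> \<Longrightarrow> f \<alpha> \<rho> \<in> borel_measurable borel"
      "\<And>\<alpha> \<rho> \<theta> t u. 0 < \<alpha> \<Longrightarrow> \<alpha> \<le> \<alpha>' \<Longrightarrow> \<rho> \<in> \<Lambda> \<Longrightarrow> \<theta> \<in> \<Theta> \<Longrightarrow> 0 \<le> t \<Longrightarrow>
         wasserstein (weighted \<rho> \<alpha>) (P \<theta> t u) (P \<theta>\<^sub>0 t u)
           \<le> ennreal (R \<alpha> \<rho> t) * f \<alpha> \<rho> u * ennreal (g \<alpha> \<rho> \<theta>)"
    and H4: "\<And>m::real. 1 \<le> m \<Longrightarrow>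
         \<exists>\<alpha>\<^sub>m>0. \<forall>\<alpha>. 0 < \<alpha> \<and> \<alpha> \<le> \<alpha>\<^sub>m \<longrightarrow>
           (\<exists>\<rho>\<in>\<Lambda>. \<exists>T>0. \<exists>C1>0. \<exists>C2>0. contraction (\<Theta> - {\<theta>\<^sub>0}) P \<rho> m \<alpha> T C1 C2)"
    and H5: "\<And>\<alpha> \<rho>. 0 < \<alpha> \<Longrightarrow> \<alpha> \<le> \<alpha>' \<Longrightarrow> \<rho> \<in> \<Lambda> \<Longrightarrow>
         continuous_on {0..} (R \<alpha> \<rho>) \<and> strict_mono_on {0..} (R \<alpha> \<rho>)"
    and H6: "\<And>\<alpha> \<rho>. 0 < \<alpha> \<Longrightarrow> \<alpha> \<le> \<alpha>' \<Longrightarrow> \<rho> \<in> \<Lambda> \<Longrightarrow>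
         bounded (g \<alpha> \<rho> ` \<Theta>) \<and> (g \<alpha> \<rho> \<longlongrightarrow> 0) (at \<theta>\<^sub>0 within \<Theta>)"
    and H7: "\<And>\<alpha> \<rho>. 0 < \<alpha> \<Longrightarrow> \<alpha> \<le> \<alpha>' \<Longrightarrow> \<rho> \<in> \<Lambda> \<Longrightarrow> (\<integral>\<^sup>+u. f \<alpha> \<rho> u \<partial>\<mu> \<theta>\<^sub>0) < \<infinity>"
    and process: "prob_space M"
      "\<And>\<theta> u\<^sub>0 t. \<theta> \<in> \<Theta> \<Longrightarrow> 0 \<le> t \<Longrightarrow> U \<theta> u\<^sub>0 t \<in> borel_measurable M"
      "\<And>\<theta> u\<^sub>0 t. \<theta> \<in> \<Theta> \<Longrightarrow> 0 \<le> t \<Longrightarrow> distr M borel (U \<theta> u\<^sub>0 t) = P \<theta> t u\<^sub>0"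
  shows
    "\<exists>\<alpha>hat. 0 < \<alpha>hat \<and> \<alpha>hat \<le> \<alpha>' \<and> (\<forall>\<alpha>. 0 < \<alpha> \<and> \<alpha> \<le> \<alpha>hat \<longrightarrow> (\<exists>\<rho>\<in>\<Lambda>.
       (\<exists>C2>0. (\<exists>m\<ge>1. \<exists>T>0. \<exists>C1>0. contraction (\<Theta> - {\<theta>\<^sub>0}) P \<rho> m \<alpha> T C1 C2) \<and>
         (\<forall>q. 0 < q \<and> q < 1 \<longrightarrow> (\<exists>C>0.
           (\<not> bounded (R \<alpha> \<rho> ` {0..}) \<longrightarrow>
              (\<forall>\<theta>\<in>\<Theta>. g \<alpha> \<rho> \<theta> \<noteq> 0 \<longrightarrow> C * g \<alpha> \<rho> \<theta> powr (- q) \<in> R \<alpha> \<rho> ` {0..})) \<and>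
           (\<forall>\<theta>\<in>\<Theta>. \<forall>u\<^sub>0 \<phi> L. f \<alpha> \<rho> u\<^sub>0 < \<infinity> \<and> dist_lipschitz (weighted \<rho> \<alpha>) L \<phi> \<longrightarrow>
              (SUP t\<in>{0..}. ennreal \<bar>\<integral>\<omega>. \<phi> (U \<theta> u\<^sub>0 t \<omega>) - \<phi> (U \<theta>\<^sub>0 u\<^sub>0 t \<omega>) \<partial>M\<bar>)
                \<le> ennreal L * ennreal (g_tilde (R \<alpha> \<rho>) C C2 q (g \<alpha> \<rho> \<theta>)) *
                   (wasserstein (weighted \<rho> (\<gamma> * \<alpha>)) (return borel u\<^sub>0) (\<mu> \<theta>\<^sub>0)
                     + f \<alpha> \<rho> u\<^sub>0 + (\<integral>\<^sup>+u. f \<alpha> \<rho> u \<partial>\<mu> \<theta>\<^sub>0)))))) \<and>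
       (\<forall>u\<^sub>0 \<phi> L. f \<alpha> \<rho> u\<^sub>0 < \<infinity> \<and> dist_lipschitz (weighted \<rho> \<alpha>) L \<phi> \<and>
          wasserstein (weighted \<rho> (\<gamma> * \<alpha>)) (return borel u\<^sub>0) (\<mu> \<theta>\<^sub>0) < \<infinity> \<longrightarrow>
          ((\<lambda>\<theta>. SUP t\<in>{0..}. ennreal \<bar>\<integral>\<omega>. \<phi> (U \<theta> u\<^sub>0 t \<omega>) - \<phi> (U \<theta>\<^sub>0 u\<^sub>0 t \<omega>) \<partial>M\<bar>) \<longlongrightarrow> 0)
            (at \<theta>\<^sub>0 within \<Theta>))))"
proof -
  obtain \<alpha>\<^sub>1 where \<alpha>\<^sub>1: "0 < \<alpha>\<^sub>1" "\<And>\<alpha>. 0 < \<alpha> \<Longrightarrow> \<alpha> \<le> \<alpha>\<^sub>1 \<Longrightarrow>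
      \<exists>\<rho>\<in>\<Lambda>. \<exists>T>0. \<exists>C1>0. \<exists>C2>0. contraction (\<Theta> - {\<theta>\<^sub>0}) P \<rho> 1 \<alpha> T C1 C2"
    using H4[of 1] by auto
  show ?thesis
  proof (intro exI[of _ "min \<alpha>' \<alpha>\<^sub>1"] conjI allI impI)
    show "0 < min \<alpha>' \<alpha>\<^sub>1" "min \<alpha>' \<alpha>\<^sub>1 \<le> \<alpha>'" using H3(1) \<alpha>\<^sub>1(1) by auto
    fix \<alpha> assume "0 < \<alpha> \<and> \<alpha> \<le> min \<alpha>' \<alpha>\<^sub>1"
    then have \<alpha>: "0 < \<alpha>" "\<alpha> \<le> \<alpha>'" "\<alpha> \<le> \<alpha>\<^sub>1" by auto
    let ?W = "\<lambda>\<rho> u\<^sub>0. wasserstein (weighted \<rho> (\<gamma> * \<alpha>)) (return borel u\<^sub>0) (\<mu> \<theta>\<^sub>0)"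
    let ?D = "\<lambda>\<theta> u\<^sub>0 \<phi>. SUP t\<in>{0..}. ennreal \<bar>\<integral>\<omega>. \<phi> (U \<theta> u\<^sub>0 t \<omega>) - \<phi> (U \<theta>\<^sub>0 u\<^sub>0 t \<omega>) \<partial>M\<bar>"
    let ?rate = "\<lambda>\<rho> C2 q. \<exists>C>0. (\<not> bounded (R \<alpha> \<rho> ` {0..}) \<longrightarrow>
          (\<forall>\<theta>\<in>\<Theta>. g \<alpha> \<rho> \<theta> \<noteq> 0 \<longrightarrow> C * g \<alpha> \<rho> \<theta> powr (- q) \<in> R \<alpha> \<rho> ` {0..})) \<and>
        (\<forall>\<theta>\<in>\<Theta>. \<forall>u\<^sub>0 \<phi> L. f \<alpha> \<rho> u\<^sub>0 < \<infinity> \<and> dist_lipschitz (weighted \<rho> \<alpha>) L \<phi> \<longrightarrow>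
          ?D \<theta> u\<^sub>0 \<phi> \<le> ennreal L * ennreal (g_tilde (R \<alpha> \<rho>) C C2 q (g \<alpha> \<rho> \<theta>)) *
            (?W \<rho> u\<^sub>0 + f \<alpha> \<rho> u\<^sub>0 + (\<integral>\<^sup>+u. f \<alpha> \<rho> u \<partial>\<mu> \<theta>\<^sub>0)))"
    let ?limit = "\<lambda>u\<^sub>0 \<phi>. ((\<lambda>\<theta>. ?D \<theta> u\<^sub>0 \<phi>) \<longlongrightarrow> 0) (at \<theta>\<^sub>0 within \<Theta>)"
    obtain \<rho> T C1 C2 where \<rho>: "\<rho> \<in> \<Lambda>" and T_pos: "0 < T" and C1: "0 < C1" and C2: "0 < C2"
      and contraction: "contraction (\<Theta> - {\<theta>\<^sub>0}) P \<rho> 1 \<alpha> T C1 C2"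
      using \<alpha>\<^sub>1(2)[OF \<alpha>(1,3)] by blast
    have dl: "distance_like \<rho>" using Lambda[OF \<rho>] by simp
    let ?d = "weighted \<rho> \<alpha>" and ?R = "R \<alpha> \<rho>" and ?g = "g \<alpha> \<rho>" and ?f = "f \<alpha> \<rho>"
    let ?F = "\<integral>\<^sup>+u. ?f u \<partial>\<mu> \<theta>\<^sub>0"
    have R: "continuous_on {0..} ?R" "strict_mono_on {0..} ?R" "\<And>t. 0 \<le> t \<Longrightarrow> 0 \<le> ?R t"
      using H5 H3(3) \<alpha> \<rho> by auto
    have g0: "0 \<le> ?g \<theta>" if "\<theta> \<in> \<Theta>" for \<theta>
      using H3(2) \<alpha> \<rho> that by auto
    have glim: "(?g \<longlongrightarrow> 0) (at \<theta>\<^sub>0 within \<Theta>)" and gbdd: "bounded (?g ` \<Theta>)"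
      using H6 \<alpha> \<rho> by auto
    have F: "?F < \<infinity>" using H7 \<alpha> \<rho> by auto
    interpret perturbed_contraction ?d \<Theta> \<theta>\<^sub>0 P \<mu> ?R ?g ?f T C1 C2
    proof
      show "kernels_close ?d (?R t * ?g \<theta>) ?f (P \<theta> t) (P \<theta>\<^sub>0 t)" if "\<theta> \<in> \<Theta>" "0 \<le> t" for \<theta> t
        using H3(5)[OF \<alpha>(1,2) \<rho> that] g0[OF that(1)] R(3)[OF that(2)]
        by (simp add: kernels_close_def ennreal_mult mult_ac)
    qed (use weighted_measurable[OF dl] weighted_nonneg[OF dl] kernel H2 theta0 g0 glim R(3)
        strict_mono_on_imp_mono_on[OF R(2)] H3(4) \<alpha> \<rho> F T_pos C1 C2
        contraction_imp_wasserstein_contracting[OF contraction] in auto)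
    \<comment> \<open>It suffices to treat bounded test functions and one time.\<close>
    have reduce: "?D \<theta> u\<^sub>0 \<phi> \<le> b"
      if \<theta>: "\<theta> \<in> \<Theta>" and \<phi>: "dist_lipschitz ?d L \<phi>"
        and b: "\<And>t \<psi>. 0 \<le> t \<Longrightarrow> bounded_lipschitz ?d L \<psi> \<Longrightarrow>
          ennreal \<bar>(\<integral>u. \<psi> u \<partial>P \<theta> t u\<^sub>0) - (\<integral>u. \<psi> u \<partial>P \<theta>\<^sub>0 t u\<^sub>0)\<bar> \<le> b" for \<theta> u\<^sub>0 \<phi> L b
    proof (rule SUP_least)
      fix t :: real assume "t \<in> {0..}"
      then have t: "0 \<le> t" by simp
      show "ennreal \<bar>\<integral>\<omega>. \<phi> (U \<theta> u\<^sub>0 t \<omega>) - \<phi> (U \<theta>\<^sub>0 u\<^sub>0 t \<omega>) \<partial>M\<bar> \<le> b"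
        using b[OF t] process(3)[OF \<theta> t] process(3)[OF theta0(1) t]
        by (intro unbounded_expectation_diff_le[OF process(1) process(2)[OF \<theta> t]
              process(2)[OF theta0(1) t] \<phi>]) simp
    qed
    have W: "wasserstein ?d (return borel u\<^sub>0) (\<mu> \<theta>\<^sub>0) \<le> ?W \<rho> u\<^sub>0" for u\<^sub>0
      using H1(1) \<alpha>(1) by (intro wasserstein_mono weighted_mono dl) simp
    obtain k where k: "0 \<le> k" "\<And>\<theta> u\<^sub>0 L \<phi> \<tau>. \<theta> \<in> \<Theta> - {\<theta>\<^sub>0} \<Longrightarrow> ?f u\<^sub>0 < \<infinity> \<Longrightarrow> T \<le> \<tau> \<Longrightarrow>
        dist_lipschitz ?d L \<phi> \<Longrightarrow>
        ?D \<theta> u\<^sub>0 \<phi> \<le> ennreal L * (ennreal (2 * C1 * exp (- \<tau> * C2)) * ?W \<rho> u\<^sub>0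
          + ennreal (?R \<tau> * ?g \<theta>) * ?f u\<^sub>0 + ennreal (k * ?g \<theta>) * ?F)"
    proof -
      obtain k where k: "0 \<le> k" "\<And>\<theta> u\<^sub>0 L \<phi> t \<tau>. \<theta> \<in> \<Theta> - {\<theta>\<^sub>0} \<Longrightarrow> ?f u\<^sub>0 < \<infinity> \<Longrightarrow> 0 \<le> t \<Longrightarrow>
          T \<le> \<tau> \<Longrightarrow> bounded_lipschitz ?d L \<phi> \<Longrightarrow>
          ennreal \<bar>(\<integral>u. \<phi> u \<partial>P \<theta> t u\<^sub>0) - (\<integral>u. \<phi> u \<partial>P \<theta>\<^sub>0 t u\<^sub>0)\<bar>
          \<le> ennreal L * (ennreal (2 * C1 * exp (- \<tau> * C2)) *
              wasserstein ?d (return borel u\<^sub>0) (\<mu> \<theta>\<^sub>0)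
              + ennreal (?R \<tau> * ?g \<theta>) * ?f u\<^sub>0 + ennreal (k * ?g \<theta>) * ?F)"
        using all_times by blast
      show thesis
      proof (rule that[OF k(1)], rule reduce)
        fix \<theta> u\<^sub>0 L \<psi> and \<tau> t :: real
        assume "\<theta> \<in> \<Theta> - {\<theta>\<^sub>0}" "?f u\<^sub>0 < \<infinity>" "T \<le> \<tau>" "0 \<le> t" "bounded_lipschitz ?d L \<psi>"
        then have "ennreal \<bar>(\<integral>u. \<psi> u \<partial>P \<theta> t u\<^sub>0) - (\<integral>u. \<psi> u \<partial>P \<theta>\<^sub>0 t u\<^sub>0)\<bar>
          \<le> ennreal L * (ennreal (2 * C1 * exp (- \<tau> * C2)) *
              wasserstein ?d (return borel u\<^sub>0) (\<mu> \<theta>\<^sub>0)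
              + ennreal (?R \<tau> * ?g \<theta>) * ?f u\<^sub>0 + ennreal (k * ?g \<theta>) * ?F)"
          by (intro k(2))
        also have "\<dots> \<le> ennreal L * (ennreal (2 * C1 * exp (- \<tau> * C2)) * ?W \<rho> u\<^sub>0
              + ennreal (?R \<tau> * ?g \<theta>) * ?f u\<^sub>0 + ennreal (k * ?g \<theta>) * ?F)"
          by (intro mult_left_mono add_mono W order_refl) auto
        finally show "ennreal \<bar>(\<integral>u. \<psi> u \<partial>P \<theta> t u\<^sub>0) - (\<integral>u. \<psi> u \<partial>P \<theta>\<^sub>0 t u\<^sub>0)\<bar>
          \<le> ennreal L * (ennreal (2 * C1 * exp (- \<tau> * C2)) * ?W \<rho> u\<^sub>0
              + ennreal (?R \<tau> * ?g \<theta>) * ?f u\<^sub>0 + ennreal (k * ?g \<theta>) * ?F)" .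
      qed auto
    qed
    have rate: "?rate \<rho> C2 q"
      if q: "0 < q" "q < 1" for q
    proof (cases "bounded (?R ` {0..})")
      \<comment> \<open>With \<open>R\<close> bounded the short-time estimate already holds uniformly in time.\<close>
      case True
      then obtain B where B: "\<And>t. 0 \<le> t \<Longrightarrow> ?R t \<le> B"
        unfolding bounded_iff by (auto simp: abs_le_iff)
      have C: "0 < max B 1" by simp
      show ?thesis
      proof (intro exI[of _ "max B 1"] conjI C ballI allI impI)
        fix \<theta> u\<^sub>0 \<phi> L
        assume \<theta>: "\<theta> \<in> \<Theta>" and "?f u\<^sub>0 < \<infinity> \<and> dist_lipschitz ?d L \<phi>"
        then have \<phi>: "dist_lipschitz ?d L \<phi>" by simp
        show "?D \<theta> u\<^sub>0 \<phi> \<le> ennreal L * ennreal (g_tilde ?R (max B 1) C2 q (?g \<theta>)) *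
            (?W \<rho> u\<^sub>0 + ?f u\<^sub>0 + ?F)"
        proof (rule reduce[OF \<theta> \<phi>])
          fix \<psi> and t :: real assume t: "0 \<le> t" and \<psi>: "bounded_lipschitz ?d L \<psi>"
          have "ennreal \<bar>(\<integral>u. \<psi> u \<partial>P \<theta> t u\<^sub>0) - (\<integral>u. \<psi> u \<partial>P \<theta>\<^sub>0 t u\<^sub>0)\<bar>
              \<le> ennreal L * (ennreal (?R t * ?g \<theta>) * ?f u\<^sub>0)"
            by (rule short_time[OF \<theta> t \<psi>])
          also have "\<dots> \<le> ennreal L * (ennreal (max B 1 * ?g \<theta>) * (?W \<rho> u\<^sub>0 + ?f u\<^sub>0 + ?F))"
            using B[OF t] g0[OF \<theta>]
            by (intro mult_left_mono mult_mono ennreal_leI mult_right_mono add_increasing2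
                add_increasing) auto
          finally show "ennreal \<bar>(\<integral>u. \<psi> u \<partial>P \<theta> t u\<^sub>0) - (\<integral>u. \<psi> u \<partial>P \<theta>\<^sub>0 t u\<^sub>0)\<bar>
              \<le> ennreal L * ennreal (g_tilde ?R (max B 1) C2 q (?g \<theta>)) * (?W \<rho> u\<^sub>0 + ?f u\<^sub>0 + ?F)"
            using True by (simp add: g_tilde_def mult.assoc)
        qed
      qed (use True in simp)
    next
      case False
      obtain G where G: "\<And>\<theta>. \<theta> \<in> \<Theta> \<Longrightarrow> ?g \<theta> \<le> G"
        using gbdd unfolding bounded_iff by (auto simp: abs_le_iff)
      have G0: "0 \<le> G"
        using g0[OF theta0(1)] G[OF theta0(1)] by simp
      have A: "0 < max (2 * C1) k" using C1 by simp
      obtain C where C: "0 < C" "\<And>x. 0 < x \<Longrightarrow> x \<le> G \<Longrightarrow> C * x powr (- q) \<in> ?R ` {0..}"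
        "\<And>x. 0 < x \<Longrightarrow> x \<le> G \<Longrightarrow> \<exists>\<tau>\<ge>T. max (2 * C1) k * exp (- \<tau> * C2) \<le> g_tilde ?R C C2 q x \<and>
          ?R \<tau> * x \<le> g_tilde ?R C C2 q x \<and> max (2 * C1) k * x \<le> g_tilde ?R C C2 q x"
        using rate_choice[OF R False _ q(1) A G0, of T C2] T by (auto simp: less_imp_le)
      show ?thesis
      proof (intro exI[of _ C] conjI C(1) ballI allI impI)
        show "C * ?g \<theta> powr (- q) \<in> ?R ` {0..}" if "\<theta> \<in> \<Theta>" "?g \<theta> \<noteq> 0" for \<theta>
          using C(2)[OF _ G[OF that(1)]] g0[OF that(1)] that(2) by simp
        fix \<theta> u\<^sub>0 \<phi> L
        assume \<theta>: "\<theta> \<in> \<Theta>" and "?f u\<^sub>0 < \<infinity> \<and> dist_lipschitz ?d L \<phi>"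
        then have u: "?f u\<^sub>0 < \<infinity>" and \<phi>: "dist_lipschitz ?d L \<phi>" by auto
        consider "\<theta> = \<theta>\<^sub>0" | "?g \<theta> = 0" | "\<theta> \<in> \<Theta> - {\<theta>\<^sub>0}" "0 < ?g \<theta>"
          using \<theta> g0[OF \<theta>] by fastforce
        then show "?D \<theta> u\<^sub>0 \<phi> \<le> ennreal L * ennreal (g_tilde ?R C C2 q (?g \<theta>)) *
            (?W \<rho> u\<^sub>0 + ?f u\<^sub>0 + ?F)"
        proof cases
          case 1
          then show ?thesis by (auto intro!: SUP_least)
        next
          \<comment> \<open>The rate is \<open>0\<close> here, so the two laws must give the same integrals.\<close>
          case 2
          have "?D \<theta> u\<^sub>0 \<phi> \<le> 0"
            by (rule reduce[OF \<theta> \<phi>]) (use short_time[OF \<theta>, of _ L _ u\<^sub>0] 2 in simp)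
          then show ?thesis by simp
        next
          case 3
          define x where "x = g_tilde ?R C C2 q (?g \<theta>)"
          obtain \<tau> where \<tau>: "T \<le> \<tau>" "max (2 * C1) k * exp (- \<tau> * C2) \<le> x" "?R \<tau> * ?g \<theta> \<le> x"
            "max (2 * C1) k * ?g \<theta> \<le> x"
            using C(3)[OF 3(2) G[OF \<theta>]] by (auto simp: x_def)
          have "2 * C1 * exp (- \<tau> * C2) \<le> x" "k * ?g \<theta> \<le> x"
            by (rule order_trans[OF mult_right_mono \<tau>(2)], simp_all)
               (rule order_trans[OF mult_right_mono \<tau>(4)], use 3(2) in simp_all)
          then have "?D \<theta> u\<^sub>0 \<phi> \<le> ennreal L * (ennreal x * ?W \<rho> u\<^sub>0 + ennreal x * ?f u\<^sub>0 + ennreal x * ?F)"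
            using \<tau>(3)
            by (intro order_trans[OF k(2)[OF 3(1) u \<tau>(1) \<phi>]] mult_left_mono add_mono
                mult_right_mono ennreal_leI) auto
          also have "\<dots> = ennreal L * ennreal x * (?W \<rho> u\<^sub>0 + ?f u\<^sub>0 + ?F)"
            by (simp add: algebra_simps)
          finally show ?thesis unfolding x_def .
        qed
      qed
    qed
    have limit: "?limit u\<^sub>0 \<phi>"
      if u: "?f u\<^sub>0 < \<infinity>" and \<phi>: "dist_lipschitz ?d L \<phi>" and W: "?W \<rho> u\<^sub>0 < \<infinity>" for u\<^sub>0 \<phi> L
    \<comment> \<open>With \<open>\<tau>\<close> free, this covers bounded and unbounded \<open>R\<close> at once: first \<open>\<tau>\<close> is chosen large to
      make the exponential term small, then \<open>\<theta>\<close> close to \<open>\<theta>\<^sub>0\<close> makes the remaining ones small.\<close>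
    proof (rule order_tendstoI)
      fix a :: ennreal assume "0 < a"
      then obtain b where b: "0 < b" "b < a"
        using dense by blast
      then have "b < top"
        using less_le_trans[OF _ top_greatest] by blast
      then obtain \<epsilon> where \<epsilon>: "0 < \<epsilon>" "ennreal \<epsilon> < a"
        using b by (auto simp: less_top_ennreal)
      have L: "0 \<le> L" using \<phi> by (simp add: dist_lipschitz_def)
      obtain w r s where w: "0 \<le> w" "?W \<rho> u\<^sub>0 = ennreal w" and r: "0 \<le> r" "?f u\<^sub>0 = ennreal r"
        and s: "0 \<le> s" "?F = ennreal s"
        using u W F by (auto simp: less_top_ennreal)
      have "((\<lambda>\<tau>. L * (2 * C1 * exp (- \<tau> * C2) * w)) \<longlongrightarrow> L * (2 * C1 * 0 * w)) at_top"
        by (intro tendsto_intros exp_decay C2)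
      then have "\<forall>\<^sub>F \<tau> in at_top. L * (2 * C1 * exp (- \<tau> * C2) * w) < \<epsilon> / 2"
        by (rule order_tendstoD) (use \<epsilon> in simp)
      then have "\<forall>\<^sub>F \<tau> in at_top. L * (2 * C1 * exp (- \<tau> * C2) * w) < \<epsilon> / 2 \<and> T \<le> \<tau>"
        by (rule eventually_conj) (rule eventually_ge_at_top)
      then obtain \<tau> where \<tau>: "L * (2 * C1 * exp (- \<tau> * C2) * w) < \<epsilon> / 2" "T \<le> \<tau>"
        using eventually_happens by fastforce
      have "((\<lambda>\<theta>. L * (?R \<tau> * ?g \<theta> * r + k * ?g \<theta> * s)) \<longlongrightarrow> L * (?R \<tau> * 0 * r + k * 0 * s))
          (at \<theta>\<^sub>0 within \<Theta>)"
        by (intro tendsto_intros glim)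
      then have "\<forall>\<^sub>F \<theta> in at \<theta>\<^sub>0 within \<Theta>. L * (?R \<tau> * ?g \<theta> * r + k * ?g \<theta> * s) < \<epsilon> / 2"
        by (rule order_tendstoD) (use \<epsilon> in simp)
      moreover have "\<forall>\<^sub>F \<theta> in at \<theta>\<^sub>0 within \<Theta>. \<theta> \<in> \<Theta> - {\<theta>\<^sub>0}"
        by (simp add: eventually_at_filter)
      ultimately show "\<forall>\<^sub>F \<theta> in at \<theta>\<^sub>0 within \<Theta>. ?D \<theta> u\<^sub>0 \<phi> < a"
      proof eventually_elim
        case (elim \<theta>)
        have nn: "0 \<le> ?R \<tau> * ?g \<theta>" "0 \<le> k * ?g \<theta>"
          using R(3) \<tau>(2) T g0 k(1) elim(2) by auto
        have "?D \<theta> u\<^sub>0 \<phi> \<le> ennreal L * (ennreal (2 * C1 * exp (- \<tau> * C2)) * ennreal w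
            + ennreal (?R \<tau> * ?g \<theta>) * ennreal r + ennreal (k * ?g \<theta>) * ennreal s)"
          using k(2)[OF elim(2) u \<tau>(2) \<phi>] unfolding w(2) r(2) s(2) .
        also have "\<dots> = ennreal (L * (2 * C1 * exp (- \<tau> * C2) * w + ?R \<tau> * ?g \<theta> * r + k * ?g \<theta> * s))"
          using L w(1) r(1) s(1) C1 nn by (simp flip: ennreal_mult ennreal_plus)
        also have "\<dots> \<le> ennreal \<epsilon>"
          using elim(1) \<tau>(1) by (intro ennreal_leI) (simp add: algebra_simps)
        also have "\<dots> < a" by (rule \<epsilon>(2))
        finally show ?case .
      qed
    qed simp
    show "\<exists>\<rho>\<in>\<Lambda>.
       (\<exists>C2>0. (\<exists>m\<ge>1. \<exists>T>0. \<exists>C1>0. contraction (\<Theta> - {\<theta>\<^sub>0}) P \<rho> m \<alpha> T C1 C2) \<and>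
         (\<forall>q. 0 < q \<and> q < 1 \<longrightarrow> ?rate \<rho> C2 q)) \<and>
       (\<forall>u\<^sub>0 \<phi> L. f \<alpha> \<rho> u\<^sub>0 < \<infinity> \<and> dist_lipschitz (weighted \<rho> \<alpha>) L \<phi> \<and> ?W \<rho> u\<^sub>0 < \<infinity> \<longrightarrow>
         ?limit u\<^sub>0 \<phi>)"
    proof (rule bexI[OF _ \<rho>], rule conjI)
      have m: "\<exists>m\<ge>1. \<exists>T>0. \<exists>C1>0. contraction (\<Theta> - {\<theta>\<^sub>0}) P \<rho> m \<alpha> T C1 C2"
        using T_pos C1 contraction order_refl[of "1::real"] by blast
      show "\<exists>C2>0. (\<exists>m\<ge>1. \<exists>T>0. \<exists>C1>0. contraction (\<Theta> - {\<theta>\<^sub>0}) P \<rho> m \<alpha> T C1 C2) \<and>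
          (\<forall>q. 0 < q \<and> q < 1 \<longrightarrow> ?rate \<rho> C2 q)"
      proof (rule exI[of _ C2], rule conjI[OF C2], rule conjI[OF m], rule allI, rule impI)
        fix q :: real assume "0 < q \<and> q < 1"
        then show "?rate \<rho> C2 q"
          by (elim conjE) (rule rate)
      qed
      show "\<forall>u\<^sub>0 \<phi> L. ?f u\<^sub>0 < \<infinity> \<and> dist_lipschitz ?d L \<phi> \<and> ?W \<rho> u\<^sub>0 < \<infinity> \<longrightarrow> ?limit u\<^sub>0 \<phi>"
      proof (intro allI impI, elim conjE)
        fix u\<^sub>0 \<phi> L assume "?f u\<^sub>0 < \<infinity>" "dist_lipschitz ?d L \<phi>" "?W \<rho> u\<^sub>0 < \<infinity>"
        then show "?limit u\<^sub>0 \<phi>"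
          by (rule limit)
      qed
    qed
  qed
qed

end
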